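(* Let $\mathcal K\colon(\mathbb Z,\le)\to\mathbf{Simp}^{\hookrightarrow}$ be a persistence simplicial complex whose transition maps are inclusions of finite simplicial complexes, let $v\in\bigcup_i\mathcal K_i$ be a vertex, let $i\le j$ and $n\ge1$. Then the $(i,j)$-persistent local Laplacian $\Delta_n^{i,j}$ of $\mathcal K$ at $v$ is unitarily equivalent to the $(i,j)$-persistent Laplacian $\Delta_{n-1}^{\mathrm{Lk},i,j}$ of the persistent link complex $\mathrm{Lk}_{\mathcal K}(v)$ in dimension $n-1$. Specifically, $$\Delta_n^{i,j}=\phi^{-1}\circ\Delta_{n-1}^{\mathrm{Lk},i,j}\circ\phi,$$ where $\phi\colon C_n(\mathcal K_i,\mathcal K_i^{\mathbf v})\to C_{n-1}(\mathrm{Lk}_i)$ is the isometric isomorphism $\phi([v,v_1,\dots,v_n])=(-1)^n[v_1,\dots,v_n]$.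
   Context: Coefficients are in $\mathbb R$; chain groups $C_n(K)$ have the inner product with the simplices as an orthonormal basis, and relative chain groups $C_n(K,L)=C_n(K)/C_n(L)$ have the quotient inner product (the quotient map restricted to $C_n(L)^\perp$ is an isometry). $f^\dagger$ denotes the Moore–Penrose pseudoinverse and $*$ the adjoint. $\mathbf{Simp}^{\hookrightarrow}$ is the category of simplicial complexes with inclusions as morphisms; a persistence simplicial complex in it is a functor from $(\mathbb Z,\le)$, i.e. a filtration $\mathcal K_i\subseteq\mathcal K_j$ for $i\le j$. Let $b=\min\{i\mid v\in\mathcal K_i\}$ be the birth index of $v$ and $\mathcal K_i^{\mathbf v}=\{\sigma\in\mathcal K_i\mid v\notin\sigma\}$ (which is $\mathcal K_i$ for $i<b$). Persistent local Laplacian: let $\bar f^{i,j}\colon C_*(\mathcal K_i,\mathcal K_i^{\mathbf v})\to C_*(\mathcal K_j,\mathcal K_j^{\mathbf v})$ be induced by inclusion, $d^i_*,d^j_*$ the relative boundary operators, $\Theta^{i,j}_{n+1}=\{x\in C_{n+1}(\mathcal K_j,\mathcal K_j^{\mathbf v})\mid d^j_{n+1}x\in\operatorname{im}\bar f^{i,j}_n\}$ with inclusion $\iota$ into $C_{n+1}(\mathcal K_j,\mathcal K_j^{\mathbf v})$, and $\delta^{i,j}_{n+1}=(\bar f^{i,j}_n)^\dagger d^j_{n+1}\iota$. Then $\Delta_n^{i,j}=\delta^{i,j}_{n+1}(\delta^{i,j}_{n+1})^*+(d^i_n)^*d^i_n$ on $C_n(\mathcal K_i,\mathcal K_i^{\mathbf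 v})$. Persistent link complex: $\mathrm{Lk}_i=\mathrm{Lk}_{\mathcal K_i}(v)=\{\sigma\in\mathcal K_i\mid v\notin\sigma,\ \sigma\cup\{v\}\in\mathcal K_i\}$ for $i\ge b$ and $\mathrm{Lk}_i=\emptyset$ for $i<b$, with inclusions as transition maps, inducing $g^{i,j}\colon C_*(\mathrm{Lk}_i)\to C_*(\mathrm{Lk}_j)$. With $d^{\mathrm{Lk},i}_*$ the boundary operator of $C_*(\mathrm{Lk}_i)$ ($d^{\mathrm{Lk},i}_0=0$), put $\Theta^{\mathrm{Lk},i,j}_n=\{x\in C_n(\mathrm{Lk}_j)\mid d^{\mathrm{Lk},j}_nx\in\operatorname{im} g^{i,j}_{n-1}\}$, $\delta^{\mathrm{Lk},i,j}_n=(g^{i,j}_{n-1})^\dagger d^{\mathrm{Lk},j}_n$ restricted to $\Theta^{\mathrm{Lk},i,j}_n$, and $$\Delta_{n-1}^{\mathrm{Lk},i,j}=\delta^{\mathrm{Lk},i,j}_n(\delta^{\mathrm{Lk},i,j}_n)^*+(d^{\mathrm{Lk},i}_{n-1})^*d^{\mathrm{Lk},i}_{n-1}\colon C_{n-1}(\mathrm{Lk}_i)\to C_{n-1}(\mathrm{Lk}_i).$$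
   Formalization: For n=1 the printed identity fails when Lk_i is nonempty (e.g. K a single edge vw: Δ_1=1 but Δ_0^Lk=0), so there Δ_0^Lk is replaced by Δ_0^Lk + ε*ε, with ε the augmentation C_0(Lk_i)→R; for n≥2 the identity is as printed. *)

theory Defs
  imports Complex_Main "HOL-Library.FuncSet"
begin

section \<open>Real inner product spaces with explicit carriers\<close>

text \<open>
  Chain groups vary with the complex, and relative chain groups are genuine quotients, so their
  elements are cosets. Both are treated as inner product spaces on an explicit carrier set.
\<close>

record 'x inner_space =
  vecs :: "'x set"
  vadd :: "'x \<Rightarrow> 'x \<Rightarrow> 'x"
  vzero :: 'x
  vscale :: "real \<Rightarrow> 'x \<Rightarrow> 'x"
  ip :: "'x \<Rightarrow> 'x \<Rightarrow> real"

definition linear_map :: "'x inner_space \<Rightarrow> 'y inner_space \<Rightarrow> ('x \<Rightarrow> 'y) \<Rightarrow> bool" where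
  "linear_map V W f \<longleftrightarrow>
     (\<forall>x\<in>vecs V. f x \<in> vecs W) \<and>
     (\<forall>x\<in>vecs V. \<forall>y\<in>vecs V. f (vadd V x y) = vadd W (f x) (f y)) \<and>
     (\<forall>r. \<forall>x\<in>vecs V. f (vscale V r x) = vscale W r (f x))"

definition isometric_isomorphism :: "'x inner_space \<Rightarrow> 'y inner_space \<Rightarrow> ('x \<Rightarrow> 'y) \<Rightarrow> bool" where
  "isometric_isomorphism V W f \<longleftrightarrow>
     linear_map V W f \<and> bij_betw f (vecs V) (vecs W) \<and>
     (\<forall>x\<in>vecs V. \<forall>y\<in>vecs V. ip W (f x) (f y) = ip V x y)"

text \<open>Adjoint and pseudoinverse are \<^const>\<open>extensional\<close> so that the descriptions are unique.\<close>

definition adjoint_map :: "'x inner_space \<Rightarrow> 'y inner_space \<Rightarrow> ('x \<Rightarrow> 'y) \<Rightarrow> 'y \<Rightarrow> 'x" where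
  "adjoint_map V W f =
     (THE g. g \<in> extensional (vecs W) \<and> linear_map W V g \<and>
        (\<forall>x\<in>vecs V. \<forall>y\<in>vecs W. ip W (f x) y = ip V x (g y)))"

definition moore_penrose :: "'x inner_space \<Rightarrow> 'y inner_space \<Rightarrow> ('x \<Rightarrow> 'y) \<Rightarrow> 'y \<Rightarrow> 'x" where
  "moore_penrose V W f =
     (THE g. g \<in> extensional (vecs W) \<and> linear_map W V g \<and>
        (\<forall>x\<in>vecs V. f (g (f x)) = f x) \<and>
        (\<forall>y\<in>vecs W. g (f (g y)) = g y) \<and>
        (\<forall>y\<in>vecs W. \<forall>y'\<in>vecs W. ip W (f (g y)) y' = ip W y (f (g y'))) \<and>
        (\<forall>x\<in>vecs V. \<forall>x'\<in>vecs V. ip V (g (f x)) x' = ip V x (g (f x'))))"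

definition quot_class :: "'x inner_space \<Rightarrow> 'x set \<Rightarrow> 'x \<Rightarrow> 'x set" where
  "quot_class V U x = {vadd V x u | u. u \<in> U}"

text \<open>
  The inner product of two cosets is that of their representatives orthogonal to \<open>U\<close>, i.e. the
  quotient map restricted to the orthogonal complement of \<open>U\<close> is an isometry.
\<close>

definition orth_rep :: "'x inner_space \<Rightarrow> 'x set \<Rightarrow> 'x set \<Rightarrow> 'x" where
  "orth_rep V U A = (THE a. a \<in> A \<and> (\<forall>u\<in>U. ip V a u = 0))"

definition quotient_space :: "'x inner_space \<Rightarrow> 'x set \<Rightarrow> 'x set inner_space" where
  "quotient_space V U =
     \<lparr>vecs = quot_class V U ` vecs V,
      vadd = (\<lambda>A B. {vadd V a b | a b. a \<in> A \<and> b \<in> B}),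
      vzero = quot_class V U (vzero V),
      vscale = (\<lambda>r A. \<Union>a\<in>A. quot_class V U (vscale V r a)),
      ip = (\<lambda>A B. ip V (orth_rep V U A) (orth_rep V U B))\<rparr>"

text \<open>
  The map of quotients induced by \<open>f\<close>, with values in \<open>W / U'\<close>. If \<open>f\<close> maps \<open>U\<close> into \<open>U'\<close>, all members
  of a coset of \<open>U\<close> contribute the same coset of \<open>U'\<close> to the union.
\<close>

definition induced_map :: "'y inner_space \<Rightarrow> 'y set \<Rightarrow> ('x \<Rightarrow> 'y) \<Rightarrow> 'x set \<Rightarrow> 'y set" where
  "induced_map W U' f A = (\<Union>a\<in>A. quot_class W U' (f a))"

section \<open>Simplicial complexes and chains\<close>

definition finite_simplicial_complex :: "'a set set \<Rightarrow> bool" where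
  "finite_simplicial_complex K \<longleftrightarrow>
     finite K \<and> (\<forall>\<sigma>\<in>K. finite \<sigma> \<and> \<sigma> \<noteq> {} \<and> (\<forall>\<tau>. \<tau> \<subseteq> \<sigma> \<and> \<tau> \<noteq> {} \<longrightarrow> \<tau> \<in> K))"

definition simplices :: "'a set set \<Rightarrow> int \<Rightarrow> 'a set set" where
  "simplices K n = {\<sigma>\<in>K. int (card \<sigma>) = n + 1}"

text \<open>
  Chains in degree \<open>n\<close> are coefficient functions on the \<open>n\<close>-simplices, each of which is oriented by
  the increasing order of its vertices; for negative \<open>n\<close> the space is zero, as simplices are nonempty.
\<close>

definition chain_space :: "'a set set \<Rightarrow> int \<Rightarrow> ('a set \<Rightarrow> real) inner_space" where
  "chain_space K n =
     \<lparr>vecs = {c. \<forall>\<sigma>. \<sigma> \<notin> simplices K n \<longrightarrow> c \<sigma> = 0},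
      vadd = (\<lambda>c d \<sigma>. c \<sigma> + d \<sigma>),
      vzero = (\<lambda>\<sigma>. 0),
      vscale = (\<lambda>r c \<sigma>. r * c \<sigma>),
      ip = (\<lambda>c d. \<Sum>\<sigma>\<in>simplices K n. c \<sigma> * d \<sigma>)\<rparr>"

text \<open>
  The oriented simplex \<open>[v\<^sub>0, \<dots>, v\<^sub>n]\<close> for distinct vertices in any order: the sign of the permutation
  that sorts them, computed by counting inversions, times the basis element \<open>{v\<^sub>0, \<dots>, v\<^sub>n}\<close>.
\<close>

definition inversions :: "'a::linorder list \<Rightarrow> (nat \<times> nat) set" where
  "inversions xs = {(p, q). p < q \<and> q < length xs \<and> xs ! q < xs ! p}"

definition oriented :: "'a::linorder list \<Rightarrow> 'a set \<Rightarrow> real" where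
  "oriented xs = (\<lambda>\<sigma>. if \<sigma> = set xs then (- 1) ^ card (inversions xs) else 0)"

definition drop_nth :: "nat \<Rightarrow> 'a list \<Rightarrow> 'a list" where
  "drop_nth k xs = take k xs @ drop (Suc k) xs"

definition boundary_simplex :: "'a::linorder list \<Rightarrow> 'a set \<Rightarrow> real" where
  "boundary_simplex xs = (\<lambda>\<tau>. \<Sum>k<length xs. (- 1) ^ k * oriented (drop_nth k xs) \<tau>)"

definition boundary :: "'a::linorder set set \<Rightarrow> int \<Rightarrow> ('a set \<Rightarrow> real) \<Rightarrow> 'a set \<Rightarrow> real" where
  "boundary K n c =
     (if n \<le> 0 then (\<lambda>\<tau>. 0)
      else (\<lambda>\<tau>. \<Sum>\<sigma>\<in>simplices K n. c \<sigma> * boundary_simplex (sorted_list_of_set \<sigma>) \<tau>))"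

definition rel_chains :: "'a set set \<Rightarrow> 'a set set \<Rightarrow> int \<Rightarrow> ('a set \<Rightarrow> real) set inner_space" where
  "rel_chains K L n = quotient_space (chain_space K n) (vecs (chain_space L n))"

definition rel_class :: "'a set set \<Rightarrow> 'a set set \<Rightarrow> int \<Rightarrow> ('a set \<Rightarrow> real) \<Rightarrow> ('a set \<Rightarrow> real) set" where
  "rel_class K L n = quot_class (chain_space K n) (vecs (chain_space L n))"

definition rel_boundary ::
  "'a::linorder set set \<Rightarrow> 'a set set \<Rightarrow> int \<Rightarrow> ('a set \<Rightarrow> real) set \<Rightarrow> ('a set \<Rightarrow> real) set" where
  "rel_boundary K L n = induced_map (chain_space K (n - 1)) (vecs (chain_space L (n - 1))) (boundary K n)"

text \<open>
  For \<open>K \<subseteq> K'\<close> the chain map \<open>C\<^sub>n(K) \<rightarrow> C\<^sub>n(K')\<close> induced by the inclusion is the identity on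
  coefficient functions; \<open>rel_inclusion K' L' n\<close> is the map it induces from \<open>C\<^sub>n(K, L)\<close> to
  \<open>C\<^sub>n(K', L')\<close> when moreover \<open>L \<subseteq> L'\<close>.
\<close>

definition inclusion :: "('a set \<Rightarrow> real) \<Rightarrow> 'a set \<Rightarrow> real" where
  "inclusion c = c"

definition rel_inclusion ::
  "'a set set \<Rightarrow> 'a set set \<Rightarrow> int \<Rightarrow> ('a set \<Rightarrow> real) set \<Rightarrow> ('a set \<Rightarrow> real) set" where
  "rel_inclusion K' L' n = induced_map (chain_space K' n) (vecs (chain_space L' n)) inclusion"

section \<open>Persistent Laplacians\<close>

text \<open>
  The common pattern of both persistent Laplacians. Here \<open>f : V \<rightarrow> W\<close> is the transition map in
  degree \<open>m\<close>, \<open>D : W1 \<rightarrow> W\<close> the boundary operator in degree \<open>m + 1\<close> at the later index, and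
  \<open>d : V \<rightarrow> V0\<close> the boundary operator in degree \<open>m\<close> at the earlier index.
\<close>

definition theta ::
  "'x inner_space \<Rightarrow> ('x \<Rightarrow> 'y) \<Rightarrow> 'z inner_space \<Rightarrow> ('z \<Rightarrow> 'y) \<Rightarrow> 'z inner_space" where
  "theta V f W1 D = W1\<lparr>vecs := {x \<in> vecs W1. D x \<in> f ` vecs V}\<rparr>"

definition persistent_boundary ::
  "'x inner_space \<Rightarrow> 'y inner_space \<Rightarrow> ('x \<Rightarrow> 'y) \<Rightarrow> ('z \<Rightarrow> 'y) \<Rightarrow> 'z \<Rightarrow> 'x" where
  "persistent_boundary V W f D x = moore_penrose V W f (D x)"

definition persistent_laplacian ::
  "'x inner_space \<Rightarrow> 'y inner_space \<Rightarrow> ('x \<Rightarrow> 'y) \<Rightarrow> 'z inner_space \<Rightarrow> ('z \<Rightarrow> 'y) \<Rightarrow>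
   'w inner_space \<Rightarrow> ('x \<Rightarrow> 'w) \<Rightarrow> 'x \<Rightarrow> 'x" where
  "persistent_laplacian V W f W1 D V0 d x =
     (let \<delta> = persistent_boundary V W f D
      in vadd V (\<delta> (adjoint_map (theta V f W1 D) V \<delta> x)) (adjoint_map V V0 d (d x)))"

definition persistence_complex :: "(int \<Rightarrow> 'a set set) \<Rightarrow> bool" where
  "persistence_complex K \<longleftrightarrow>
     (\<forall>i. finite_simplicial_complex (K i)) \<and> (\<forall>i j. i \<le> j \<longrightarrow> K i \<subseteq> K j)"

definition antistar :: "'a set set \<Rightarrow> 'a \<Rightarrow> 'a set set" where
  "antistar K v = {\<sigma>\<in>K. v \<notin> \<sigma>}"

abbreviation local_chains :: "(int \<Rightarrow> 'a set set) \<Rightarrow> 'a \<Rightarrow> int \<Rightarrow> int \<Rightarrow> ('a set \<Rightarrow> real) set inner_space" where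
  "local_chains K v i n \<equiv> rel_chains (K i) (antistar (K i) v) n"

definition persistent_local_laplacian ::
  "(int \<Rightarrow> 'a::linorder set set) \<Rightarrow> 'a \<Rightarrow> int \<Rightarrow> int \<Rightarrow> int \<Rightarrow> ('a set \<Rightarrow> real) set \<Rightarrow> ('a set \<Rightarrow> real) set" where
  "persistent_local_laplacian K v i j n =
     persistent_laplacian
       (local_chains K v i n) (local_chains K v j n) (rel_inclusion (K j) (antistar (K j) v) n)
       (local_chains K v j (n + 1)) (rel_boundary (K j) (antistar (K j) v) (n + 1))
       (local_chains K v i (n - 1)) (rel_boundary (K i) (antistar (K i) v) n)"

definition link :: "'a set set \<Rightarrow> 'a \<Rightarrow> 'a set set" where
  "link K v = {\<sigma>\<in>K. v \<notin> \<sigma> \<and> \<sigma> \<union> {v} \<in> K}"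

text \<open>
  The condition \<open>{v} \<in> K i\<close> says that \<open>i\<close> is at or after the birth index of \<open>v\<close>. Unlike the birth
  index, it also makes sense when \<open>v\<close> belongs to every \<open>K i\<close>.
\<close>

definition persistent_link :: "(int \<Rightarrow> 'a set set) \<Rightarrow> 'a \<Rightarrow> int \<Rightarrow> 'a set set" where
  "persistent_link K v i = (if {v} \<in> K i then link (K i) v else {})"

text \<open>The ordinary persistent Laplacian of a filtration, with zero boundary operator in degree 0.\<close>

definition persistent_complex_laplacian ::
  "(int \<Rightarrow> 'a::linorder set set) \<Rightarrow> int \<Rightarrow> int \<Rightarrow> int \<Rightarrow> ('a set \<Rightarrow> real) \<Rightarrow> 'a set \<Rightarrow> real" where
  "persistent_complex_laplacian L i j m =
     persistent_laplacian
       (chain_space (L i) m) (chain_space (L j) m) inclusion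
       (chain_space (L j) (m + 1)) (boundary (L j) (m + 1))
       (chain_space (L i) (m - 1)) (boundary (L i) m)"

text \<open>
  In relative degree 1 the boundary of \<open>[v, w]\<close> is \<open>-[v]\<close>, which is nonzero modulo the antistar,
  whereas the corresponding boundary \<open>d\<^sub>0\<close> of the link is zero. The matching down-Laplacian in
  degree 0 of the link is the one of the augmentation \<open>C\<^sub>0 \<rightarrow> \<real>\<close>.
\<close>

definition real_line :: "real inner_space" where
  "real_line = \<lparr>vecs = UNIV, vadd = (+), vzero = 0, vscale = (*), ip = (*)\<rparr>"

definition augmentation :: "'a set set \<Rightarrow> ('a set \<Rightarrow> real) \<Rightarrow> real" where
  "augmentation L c = (\<Sum>\<sigma>\<in>simplices L 0. c \<sigma>)"

definition augmentation_laplacian :: "'a set set \<Rightarrow> ('a set \<Rightarrow> real) \<Rightarrow> 'a set \<Rightarrow> real" where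
  "augmentation_laplacian L c = adjoint_map (chain_space L 0) real_line (augmentation L) (augmentation L c)"

end

theory Submission
  imports Defs
begin

text \<open>
  Modulo the antistar of \<open>v\<close> only simplices containing \<open>v\<close> survive, and removing \<open>v\<close> identifies
  them with the simplices of the link. With the sign that moves \<open>v\<close> to the front of a simplex and
  the factor \<open>(-1)^n\<close>, this identification is isometric, commutes with the inclusions, and commutes
  with the boundary operators exactly, not just up to sign. Since the transition maps are isometric
  embeddings, their Moore--Penrose inverses are their adjoints, so a persistent Laplacian is built
  from composition, sums and adjoints alone, and all of these are transported by isometric
  isomorphisms. In relative degree 0 the link has no simplex to offer; there the coefficient of
  \<open>[v]\<close> plays the role of the isometry and turns the relative boundary into the augmentation.
\<close>

section \<open>Adjoints in finite-dimensional inner product spaces\<close>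

text \<open>The spaces involved consist of functions, of cosets and of real numbers, and
  \<open>theta\<close> is cut out by a condition that leaves it without a basis of simplices.
  Adjoints therefore cannot be read off as transposed matrices: they come from the Riesz theorem for
  arbitrary subspaces of a finite coordinate space, and equations between vectors are proved by
  testing against all vectors of the carrier. The exact commutation with the boundary has one
  source. A vertex \<open>v\<close> in front shifts every other vertex by one place, so the relative
  boundary and the boundary of the link differ by -1 in each degree; a factor that alternates with
  the degree absorbs this. The exception at \<open>n = 1\<close> is confined to the down part. The
  up part lives in relative degrees \<open>n\<close> and \<open>n + 1\<close>, both at least 1,
  whereas the down part reaches \<open>n - 1\<close>. In relative degree 0 the chain group is
  spanned by \<open>[v]\<close> once \<open>v\<close> is born, while the link has no chains of
  dimension -1 to match it.\<close>

lemma riesz_coordinates: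
  fixes S :: "('b \<Rightarrow> real) set" and l :: "('b \<Rightarrow> real) \<Rightarrow> real"
  assumes "finite B" "S \<noteq> {}"
    and "\<And>x y. x \<in> S \<Longrightarrow> y \<in> S \<Longrightarrow> (\<lambda>b. x b + y b) \<in> S"
    and "\<And>r x. x \<in> S \<Longrightarrow> (\<lambda>b. r * x b) \<in> S"
    and "\<And>x b. x \<in> S \<Longrightarrow> b \<notin> B \<Longrightarrow> x b = 0"
    and "\<And>x y. x \<in> S \<Longrightarrow> y \<in> S \<Longrightarrow> l (\<lambda>b. x b + y b) = l x + l y"
    and "\<And>r x. x \<in> S \<Longrightarrow> l (\<lambda>b. r * x b) = r * l x"
  shows "\<exists>s\<in>S. \<forall>x\<in>S. l x = (\<Sum>b\<in>B. x b * s b)"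
  using assms
proof (induction B arbitrary: S l rule: finite_induct)
  case empty
  then obtain s where s: "s \<in> S" by blast
  have "x = (\<lambda>b. 0 * x b)" if "x \<in> S" for x
    using empty.prems(4) that by auto
  then have "l x = 0" if "x \<in> S" for x
    using empty.prems(6)[of x 0] that by (metis mult_zero_left)
  with s show ?case by auto
next
  case (insert b B)
  note add = insert.prems(2) and scale = insert.prems(3) and supp = insert.prems(4)
    and l_add = insert.prems(5) and l_scale = insert.prems(6)
  \<comment> \<open>\<open>S0\<close> is all of \<open>S\<close> or a hyperplane in it. Its vectors
    live on \<open>B\<close>, so the induction hypothesis applies; a normal vector in
    \<open>S\<close> supplies the one missing direction.\<close>
  define S0 where "S0 = {x \<in> S. x b = 0}"
  have S0: "S0 \<subseteq> S" by (auto simp: S0_def)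
  have IH: "\<exists>s\<in>S0. \<forall>x\<in>S0. k x = (\<Sum>b\<in>B. x b * s b)"
    if "\<And>x y. x \<in> S \<Longrightarrow> y \<in> S \<Longrightarrow> k (\<lambda>b. x b + y b) = k x + k y"
      "\<And>r x. x \<in> S \<Longrightarrow> k (\<lambda>b. r * x b) = r * k x" for k
  proof (rule insert.IH)
    obtain x where "x \<in> S" using insert.prems(1) by blast
    then have "(\<lambda>b. 0 * x b) \<in> S0" using scale[of x 0] by (simp add: S0_def)
    then show "S0 \<noteq> {}" by blast
    show "x c = 0" if "x \<in> S0" "c \<notin> B" for x c
      using that supp[of x c] by (cases "c = b") (auto simp: S0_def)
  qed (use add scale that in \<open>auto simp: S0_def\<close>)
  let ?ip = "\<lambda>x y. \<Sum>c\<in>insert b B. x c * y c"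
  have ip0: "?ip x s = (\<Sum>c\<in>B. x c * s c)" if "s \<in> S0" for x s :: "'b \<Rightarrow> real"
    using that insert.hyps by (simp add: S0_def)
  have ip_add: "?ip (\<lambda>c. x c + y c) s = ?ip x s + ?ip y s" for x y s :: "'b \<Rightarrow> real"
    by (simp only: distrib_right sum.distrib)
  have ip_scale: "?ip (\<lambda>c. r * x c) s = r * ?ip x s" for r and x s :: "'b \<Rightarrow> real"
    by (simp only: mult.assoc sum_distrib_left)
  \<comment> \<open>Kept general in \<open>k\<close>: it serves both for \<open>l\<close> and for
    the pairing with a fixed vector of \<open>S\<close>.\<close>
  have sub: "\<exists>s\<in>S0. \<forall>x\<in>S0. k x = ?ip x s"
    if k: "\<And>x y. x \<in> S \<Longrightarrow> y \<in> S \<Longrightarrow> k (\<lambda>b. x b + y b) = k x + k y"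
      "\<And>r x. x \<in> S \<Longrightarrow> k (\<lambda>b. r * x b) = r * k x" for k
  proof -
    obtain s where "s \<in> S0" "\<forall>x\<in>S0. k x = (\<Sum>b\<in>B. x b * s b)" using IH[of k, OF k] by blast
    then show ?thesis by (intro bexI[of _ s]) (simp_all only: ip0 simp_thms)
  qed
  obtain s0 where s0: "s0 \<in> S0" "\<And>x. x \<in> S0 \<Longrightarrow> l x = ?ip x s0"
    using sub[of l] l_add l_scale by blast
  show ?case
  proof (cases "S0 = S")
    case True
    then show ?thesis using s0 by blast
  next
    case False
    then obtain y where y: "y \<in> S" "y b \<noteq> 0" by (auto simp: S0_def)
    \<comment> \<open>Representing the pairing with \<open>y\<close> on \<open>S0\<close> yields the
      orthogonal projection \<open>p\<close> of \<open>y\<close>, so \<open>y - p\<close> is normal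
      to \<open>S0\<close>.\<close>
    obtain p where p: "p \<in> S0" "\<And>x. x \<in> S0 \<Longrightarrow> ?ip x y = ?ip x p"
      using sub[of "\<lambda>x. ?ip x y", OF ip_add ip_scale] by blast
    define z where "z = (\<lambda>c. y c + (-1) * p c)"
    have zS: "z \<in> S" unfolding z_def using add[OF y(1) scale[of p "-1"]] p(1) S0 by blast
    have zb: "z b \<noteq> 0" using y p(1) by (simp add: z_def S0_def)
    have orth: "?ip x z = 0" if "x \<in> S0" for x
    proof -
      have "?ip x z = ?ip x y - ?ip x p"
        by (simp add: z_def sum_subtractf[symmetric] algebra_simps del: sum.insert)
      then show ?thesis using p(2)[OF that] by simp
    qed
    have "?ip z z > 0"
    proof (rule sum_pos2[of _ b])
      show "0 < z b * z b" using zb by (auto simp: zero_less_mult_iff)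
    qed (use insert.hyps in auto)
    \<comment> \<open>Since \<open>s0\<close> is orthogonal to \<open>z\<close>, the equation
      \<open>l z = ?ip z s\<close> forces this value.\<close>
    define t where "t = l z / ?ip z z"
    define s where "s = (\<lambda>c. s0 c + t * z c)"
    have sS: "s \<in> S" unfolding s_def using add[OF _ scale[OF zS]] s0(1) S0 by blast
    have ip_s: "?ip x s = ?ip x s0 + t * ?ip x z" for x
      by (simp only: s_def distrib_left sum.distrib sum_distrib_left mult.left_commute)
    have zs0: "?ip z s0 = 0"
      using orth[OF s0(1)] by (simp only: mult.commute)
    have lz: "l z = ?ip z s"
      unfolding ip_s zs0 t_def using \<open>?ip z z > 0\<close> by simp
    have "l x = ?ip x s" if x: "x \<in> S" for x
    proof -
      \<comment> \<open>This multiple of \<open>z\<close> cancels the coordinate \<open>b\<close> of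
        \<open>x\<close>.\<close>
      define r where "r = x b / z b"
      define x0 where "x0 = (\<lambda>c. x c + (- r) * z c)"
      have x0S: "x0 \<in> S" unfolding x0_def by (rule add[OF x scale[OF zS]])
      then have x0: "x0 \<in> S0" using zb by (simp add: S0_def x0_def r_def)
      have xeq: "x = (\<lambda>c. x0 c + r * z c)" by (simp add: x0_def)
      have "l x = l x0 + r * l z"
        by (subst xeq) (simp only: l_add[OF x0S scale[OF zS]] l_scale[OF zS])
      also have "l x0 = ?ip x0 s" using s0(2)[OF x0] orth[OF x0] ip_s by simp
      also have "?ip x0 s + r * l z = ?ip x s"
        by (subst xeq) (simp only: lz ip_add ip_scale)
      finally show ?thesis .
    qed
    then show ?thesis using sS by blast
  qed
qed

text \<open>\<open>\<kappa>\<close> is injective but need not be onto, so that \<open>theta\<close>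
  can keep the coordinates of the space around it. Vector space laws and positive definiteness are
  inherited from the coordinate space through injectivity.\<close>

locale coordinatized =
  fixes V :: "'x inner_space" and B :: "'b set" and \<kappa> :: "'x \<Rightarrow> 'b \<Rightarrow> real"
  assumes finite_coords: "finite B"
    and nonempty: "vecs V \<noteq> {}"
    and add_closed: "x \<in> vecs V \<Longrightarrow> y \<in> vecs V \<Longrightarrow> vadd V x y \<in> vecs V"
    and scale_closed: "x \<in> vecs V \<Longrightarrow> vscale V r x \<in> vecs V"
    and coord_add: "x \<in> vecs V \<Longrightarrow> y \<in> vecs V \<Longrightarrow> \<kappa> (vadd V x y) = (\<lambda>b. \<kappa> x b + \<kappa> y b)"
    and coord_scale: "x \<in> vecs V \<Longrightarrow> \<kappa> (vscale V r x) = (\<lambda>b. r * \<kappa> x b)"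
    and coord_ip: "x \<in> vecs V \<Longrightarrow> y \<in> vecs V \<Longrightarrow> ip V x y = (\<Sum>b\<in>B. \<kappa> x b * \<kappa> y b)"
    and coord_supp: "x \<in> vecs V \<Longrightarrow> b \<notin> B \<Longrightarrow> \<kappa> x b = 0"
    and coord_inj: "inj_on \<kappa> (vecs V)"
begin

section \<open>Inner product laws and the Riesz theorem\<close>

lemma ip_commute: "x \<in> vecs V \<Longrightarrow> y \<in> vecs V \<Longrightarrow> ip V x y = ip V y x"
  by (simp add: coord_ip mult.commute)

lemma ip_add_left:
  "x \<in> vecs V \<Longrightarrow> y \<in> vecs V \<Longrightarrow> z \<in> vecs V \<Longrightarrow> ip V (vadd V x y) z = ip V x z + ip V y z"
  by (simp add: coord_ip add_closed coord_add distrib_right sum.distrib)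

lemma ip_scale_left:
  "x \<in> vecs V \<Longrightarrow> z \<in> vecs V \<Longrightarrow> ip V (vscale V r x) z = r * ip V x z"
  by (simp add: coord_ip scale_closed coord_scale sum_distrib_left mult.assoc)

lemma ip_add_right:
  "x \<in> vecs V \<Longrightarrow> y \<in> vecs V \<Longrightarrow> z \<in> vecs V \<Longrightarrow> ip V z (vadd V x y) = ip V z x + ip V z y"
  by (simp add: coord_ip add_closed coord_add distrib_left sum.distrib)

lemma ip_scale_right:
  "x \<in> vecs V \<Longrightarrow> z \<in> vecs V \<Longrightarrow> ip V z (vscale V r x) = r * ip V z x"
  by (simp add: ip_commute[of z] scale_closed ip_scale_left)

lemma ip_nondegenerate:
  assumes x: "x \<in> vecs V" and y: "y \<in> vecs V"
    and eq: "\<And>z. z \<in> vecs V \<Longrightarrow> ip V z x = ip V z y"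
  shows "x = y"
proof (rule inj_onD[OF coord_inj _ x y])
  define w where "w = vadd V x (vscale V (- 1) y)"
  have w: "w \<in> vecs V" using x y by (simp add: w_def add_closed scale_closed)
  \<comment> \<open>Only the second \<open>w\<close> is expanded; the first remains as the vector on
    which \<open>eq\<close> is tested.\<close>
  have "ip V w w = 0"
    using eq[OF w] x y w
    by (subst (2) w_def) (simp add: ip_add_right ip_scale_right scale_closed)
  then have "(\<Sum>b\<in>B. \<kappa> w b * \<kappa> w b) = 0" using w by (simp add: coord_ip)
  then have "\<kappa> w b = 0" if "b \<in> B" for b
    using that finite_coords by (simp add: sum_nonneg_eq_0_iff)
  then have "\<kappa> w b = 0" for b using w by (cases "b \<in> B") (auto simp: coord_supp)
  then show "\<kappa> x = \<kappa> y"
    using x y by (simp add: w_def coord_add coord_scale scale_closed fun_eq_iff)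
qed

lemma riesz:
  assumes l_add: "\<And>x y. x \<in> vecs V \<Longrightarrow> y \<in> vecs V \<Longrightarrow> l (vadd V x y) = l x + l y"
    and l_scale: "\<And>r x. x \<in> vecs V \<Longrightarrow> l (vscale V r x) = r * l x"
  shows "\<exists>s\<in>vecs V. \<forall>x\<in>vecs V. l x = ip V x s"
proof -
  let ?l = "\<lambda>c. l (inv_into (vecs V) \<kappa> c)"
  have l: "?l (\<kappa> x) = l x" if "x \<in> vecs V" for x
    using that by (simp add: coord_inj)
  have "\<exists>s\<in>\<kappa> ` vecs V. \<forall>c\<in>\<kappa> ` vecs V. ?l c = (\<Sum>b\<in>B. c b * s b)"
  proof (rule riesz_coordinates)
    fix c d assume "c \<in> \<kappa> ` vecs V" "d \<in> \<kappa> ` vecs V"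
    then obtain x y where xy: "x \<in> vecs V" "y \<in> vecs V" "c = \<kappa> x" "d = \<kappa> y" by blast
    then have cd: "(\<lambda>b. c b + d b) = \<kappa> (vadd V x y)" by (simp add: coord_add)
    then show "(\<lambda>b. c b + d b) \<in> \<kappa> ` vecs V" using xy by (simp add: add_closed)
    show "?l (\<lambda>b. c b + d b) = ?l c + ?l d"
      unfolding cd using xy by (simp add: l add_closed l_add)
  next
    fix r c assume "c \<in> \<kappa> ` vecs V"
    then obtain x where x: "x \<in> vecs V" "c = \<kappa> x" by blast
    then have c: "(\<lambda>b. r * c b) = \<kappa> (vscale V r x)" by (simp add: coord_scale)
    then show "(\<lambda>b. r * c b) \<in> \<kappa> ` vecs V" using x by (simp add: scale_closed)
    show "?l (\<lambda>b. r * c b) = r * ?l c"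
      unfolding c using x by (simp add: l scale_closed l_scale)
  qed (use finite_coords nonempty coord_supp in auto)
  then show ?thesis using l coord_ip by auto
qed

lemma coordinatized_subspace:
  assumes "U \<subseteq> vecs V" "U \<noteq> {}"
    and "\<And>x y. x \<in> U \<Longrightarrow> y \<in> U \<Longrightarrow> vadd V x y \<in> U"
    and "\<And>r x. x \<in> U \<Longrightarrow> vscale V r x \<in> U"
  shows "coordinatized (V\<lparr>vecs := U\<rparr>) B \<kappa>"
  using assms finite_coords coord_add coord_scale coord_ip coord_supp inj_on_subset[OF coord_inj]
  by unfold_locales (auto simp: subset_iff)

end

section \<open>Existence and uniqueness of adjoints\<close>

definition is_adjoint where
  "is_adjoint V W f g \<longleftrightarrow> g \<in> extensional (vecs W) \<and> linear_map W V g \<and>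
     (\<forall>x\<in>vecs V. \<forall>y\<in>vecs W. ip W (f x) y = ip V x (g y))"

text \<open>The Riesz theorem is applied to each \<open>y\<close> separately. Nondegeneracy makes
  each value unique, and this uniqueness gives linearity of the chosen values as well as uniqueness
  of the adjoint.\<close>

lemma is_adjoint_adjoint_map:
  assumes V: "coordinatized V B \<kappa>" and W: "coordinatized W C \<mu>" and f: "linear_map V W f"
  shows "is_adjoint V W f (adjoint_map V W f)"
proof -
  interpret V: coordinatized V B \<kappa> by fact
  interpret W: coordinatized W C \<mu> by fact
  have f_in: "x \<in> vecs V \<Longrightarrow> f x \<in> vecs W" for x using f by (simp add: linear_map_def)
  have "\<exists>s\<in>vecs V. \<forall>x\<in>vecs V. ip W (f x) y = ip V x s" if "y \<in> vecs W" for y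
    using f that
    by (intro V.riesz) (auto simp: linear_map_def W.ip_add_left W.ip_scale_left)
  then obtain h where h: "\<And>y. y \<in> vecs W \<Longrightarrow> h y \<in> vecs V"
    "\<And>x y. x \<in> vecs V \<Longrightarrow> y \<in> vecs W \<Longrightarrow> ip W (f x) y = ip V x (h y)" by metis
  have h_add: "h (vadd W y z) = vadd V (h y) (h z)" if "y \<in> vecs W" "z \<in> vecs W" for y z
    using that
    by (intro V.ip_nondegenerate) (auto simp: h(1) h(2)[symmetric] W.add_closed V.add_closed f_in V.ip_add_right W.ip_add_right)
  have h_scale: "h (vscale W r y) = vscale V r (h y)" if "y \<in> vecs W" for r y
    using that
    by (intro V.ip_nondegenerate) (auto simp: h(1) h(2)[symmetric] W.scale_closed V.scale_closed f_in V.ip_scale_right W.ip_scale_right)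
  have "is_adjoint V W f (restrict h (vecs W))"
    using h h_add h_scale by (auto simp: is_adjoint_def linear_map_def W.add_closed W.scale_closed)
  moreover have "g = k" if g: "is_adjoint V W f g" and k: "is_adjoint V W f k" for g k
  proof (rule extensionalityI[of _ "vecs W"])
    fix y assume "y \<in> vecs W"
    then show "g y = k y"
      using g k by (intro V.ip_nondegenerate) (auto simp: is_adjoint_def linear_map_def)
  qed (use g k in \<open>auto simp: is_adjoint_def\<close>)
  ultimately have "\<exists>!g. is_adjoint V W f g" by blast
  then show ?thesis
    unfolding adjoint_map_def is_adjoint_def by (rule theI')
qed

text \<open>The working rule for adjoints: a single value is identified by its pairings alone,
  without exhibiting a competing linear map.\<close>

lemma adjoint_map_eqI:
  assumes V: "coordinatized V B \<kappa>" and W: "coordinatized W C \<mu>" and f: "linear_map V W f"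
    and y: "y \<in> vecs W" and z: "z \<in> vecs V"
    and eq: "\<And>x. x \<in> vecs V \<Longrightarrow> ip W (f x) y = ip V x z"
  shows "adjoint_map V W f y = z"
  using is_adjoint_adjoint_map[OF V W f] y z eq
  by (intro coordinatized.ip_nondegenerate[OF V]) (auto simp: is_adjoint_def linear_map_def)

text \<open>Surjectivity is left out because transition maps are rarely onto, and neither is the
  coefficient of \<open>[v]\<close> before \<open>v\<close> is born.\<close>

definition isometric_map :: "'x inner_space \<Rightarrow> 'y inner_space \<Rightarrow> ('x \<Rightarrow> 'y) \<Rightarrow> bool" where
  "isometric_map V W f \<longleftrightarrow>
     linear_map V W f \<and> (\<forall>x\<in>vecs V. \<forall>y\<in>vecs V. ip W (f x) (f y) = ip V x y)"

lemma isometric_isomorphism_imp_map: "isometric_isomorphism V W f \<Longrightarrow> isometric_map V W f"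
  by (simp add: isometric_isomorphism_def isometric_map_def)

text \<open>For linear \<open>g\<close> the four Penrose conditions together are equivalent to
  \<open>g\<close> being the adjoint. Both definite descriptions then range over the same predicate,
  so existence of the pseudoinverse takes no separate argument.\<close>

lemma moore_penrose_isometric_map:
  assumes V: "coordinatized V B \<kappa>" and W: "coordinatized W C \<mu>" and f: "isometric_map V W f"
  shows "moore_penrose V W f = adjoint_map V W f"
proof -
  interpret V: coordinatized V B \<kappa> by fact
  interpret W: coordinatized W C \<mu> by fact
  have f_in: "f x \<in> vecs W" if "x \<in> vecs V" for x
    using f that by (simp add: isometric_map_def linear_map_def)
  have f_ip: "ip W (f x) (f y) = ip V x y" if "x \<in> vecs V" "y \<in> vecs V" for x y
    using f that by (simp add: isometric_map_def)
  have f_inj: "x = y" if "x \<in> vecs V" "y \<in> vecs V" "f x = f y" for x y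
    using that f_ip by (metis V.ip_nondegenerate)
  have mp_iff: "((\<forall>x\<in>vecs V. f (g (f x)) = f x) \<and> (\<forall>y\<in>vecs W. g (f (g y)) = g y) \<and>
      (\<forall>y\<in>vecs W. \<forall>y'\<in>vecs W. ip W (f (g y)) y' = ip W y (f (g y'))) \<and>
      (\<forall>x\<in>vecs V. \<forall>x'\<in>vecs V. ip V (g (f x)) x' = ip V x (g (f x')))) \<longleftrightarrow>
    (\<forall>x\<in>vecs V. \<forall>y\<in>vecs W. ip W (f x) y = ip V x (g y))"
    (is "?mp \<longleftrightarrow> ?adj") if g: "linear_map W V g" for g
  proof
    have g_in: "g y \<in> vecs V" if "y \<in> vecs W" for y
      using g that by (simp add: linear_map_def)
    show ?adj if ?mp
    proof (intro ballI)
      fix x y assume x: "x \<in> vecs V" and y: "y \<in> vecs W"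
      have "ip V x (g y) = ip W (f x) (f (g y))" using x y by (simp add: f_ip g_in)
      also have "\<dots> = ip W (f (g (f x))) y" using that f_in[OF x] y by metis
      also have "f (g (f x)) = f x" using that x by blast
      finally show "ip W (f x) y = ip V x (g y)" by simp
    qed
    show ?mp if adj: ?adj
    proof -
      \<comment> \<open>An isometric map composed with its adjoint is the identity. This settles
        three of the four conditions; only the symmetry of \<open>f\<close> after \<open>g\<close>
        remains.\<close>
      have gf: "g (f x) = x" if "x \<in> vecs V" for x
        using that adj by (intro V.ip_nondegenerate) (auto simp: f_in g_in f_ip[symmetric])
      have "ip W (f (g y)) y' = ip W y (f (g y'))" if "y \<in> vecs W" "y' \<in> vecs W" for y y'
      proof -
        have "ip W (f (g y)) y' = ip V (g y) (g y')" using that adj g_in by simp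
        also have "\<dots> = ip W (f (g y')) y" using that adj g_in by (simp add: V.ip_commute)
        finally show ?thesis using that by (simp add: W.ip_commute f_in g_in)
      qed
      then show ?mp using gf g_in by simp
    qed
  qed
  \<comment> \<open>Linearity of \<open>g\<close> is a conjunct of both predicates;
    \<open>conj_cong\<close> turns it into the premise of \<open>mp_iff\<close>.\<close>
  show ?thesis
    unfolding moore_penrose_def adjoint_map_def
    by (rule arg_cong[where f = The], rule ext, (rule conj_cong[OF refl])+, erule mp_iff)
qed

section \<open>Transport along isometric isomorphisms\<close>

text \<open>The defining pairing is carried along the commuting square. \<open>p\<close> has to be
  onto, since the test vectors range over \<open>V'\<close>; \<open>q\<close> only has to preserve
  inner products, which admits the coefficient of \<open>[v]\<close> as \<open>q\<close>.\<close>

lemma adjoint_map_transport: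
  assumes V: "coordinatized V B \<kappa>" and W: "coordinatized W C \<mu>" and f: "linear_map V W f"
    and V': "coordinatized V' B' \<kappa>'" and W': "coordinatized W' C' \<mu>'" and f': "linear_map V' W' f'"
    and p: "isometric_isomorphism V V' p" and q: "isometric_map W W' q"
    and comm: "\<And>x. x \<in> vecs V \<Longrightarrow> q (f x) = f' (p x)"
    and y: "y \<in> vecs W"
  shows "p (adjoint_map V W f y) = adjoint_map V' W' f' (q y)"
proof (rule adjoint_map_eqI[OF V' W' f', symmetric])
  have g: "is_adjoint V W f (adjoint_map V W f)" by (rule is_adjoint_adjoint_map[OF V W f])
  then have gy: "adjoint_map V W f y \<in> vecs V" using y by (simp add: is_adjoint_def linear_map_def)
  then show "p (adjoint_map V W f y) \<in> vecs V'"
    using p by (simp add: isometric_isomorphism_def linear_map_def)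
  show "q y \<in> vecs W'" using q y by (simp add: isometric_map_def linear_map_def)
  fix x' assume "x' \<in> vecs V'"
  then obtain x where x: "x \<in> vecs V" "x' = p x"
    using p unfolding isometric_isomorphism_def bij_betw_def by blast
  have "ip W' (f' x') (q y) = ip W (f x) y"
    using q f x y comm by (simp add: isometric_map_def linear_map_def flip: comm)
  also have "\<dots> = ip V x (adjoint_map V W f y)" using g x y by (simp add: is_adjoint_def)
  also have "\<dots> = ip V' x' (p (adjoint_map V W f y))"
    using p x gy by (simp add: isometric_isomorphism_def)
  finally show "ip W' (f' x') (q y) = ip V' x' (p (adjoint_map V W f y))" .
qed

section \<open>Transport of \<open>theta\<close> and of the up part\<close>

lemma linear_map_compose:
  "linear_map U V f \<Longrightarrow> linear_map V W g \<Longrightarrow> linear_map U W (\<lambda>x. g (f x))"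
  by (simp add: linear_map_def)

lemma coordinatized_theta:
  assumes V: "coordinatized V B \<kappa>" and W: "coordinatized W C \<mu>" and W1: "coordinatized W1 E \<nu>"
    and f: "linear_map V W f" and D: "linear_map W1 W D"
  shows "coordinatized (theta V f W1 D) E \<nu>"
proof -
  interpret V: coordinatized V B \<kappa> by fact
  interpret W: coordinatized W C \<mu> by fact
  interpret W1: coordinatized W1 E \<nu> by fact
  obtain x w where xw: "x \<in> vecs V" "w \<in> vecs W1" using V.nonempty W1.nonempty by blast
  \<comment> \<open>Zero vectors are written as multiples by 0; nondegeneracy makes them all
    equal.\<close>
  have zero: "vscale W 0 y = vscale W 0 z" if "y \<in> vecs W" "z \<in> vecs W" for y z
    using that by (intro W.ip_nondegenerate) (auto simp: W.scale_closed W.ip_scale_right)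
  show ?thesis
    unfolding theta_def
  proof (rule W1.coordinatized_subspace)
    have "D (vscale W1 0 w) = f (vscale V 0 x)"
      using f D xw by (auto simp: linear_map_def intro: zero)
    then show "{x \<in> vecs W1. D x \<in> f ` vecs V} \<noteq> {}"
      using xw W1.scale_closed V.scale_closed by blast
  next
    fix x y assume "x \<in> {x \<in> vecs W1. D x \<in> f ` vecs V}" "y \<in> {x \<in> vecs W1. D x \<in> f ` vecs V}"
    then obtain a b where *: "x \<in> vecs W1" "y \<in> vecs W1" "a \<in> vecs V" "b \<in> vecs V" "D x = f a" "D y = f b"
      by blast
    then have "D (vadd W1 x y) = f (vadd V a b)" using f D by (simp add: linear_map_def)
    then show "vadd W1 x y \<in> {x \<in> vecs W1. D x \<in> f ` vecs V}"
      using * W1.add_closed V.add_closed by blast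
  next
    fix r x assume "x \<in> {x \<in> vecs W1. D x \<in> f ` vecs V}"
    then obtain a where *: "x \<in> vecs W1" "a \<in> vecs V" "D x = f a" by blast
    then have "D (vscale W1 r x) = f (vscale V r a)" using f D by (simp add: linear_map_def)
    then show "vscale W1 r x \<in> {x \<in> vecs W1. D x \<in> f ` vecs V}"
      using * W1.scale_closed V.scale_closed by blast
  qed blast
qed

lemma vecs_theta: "vecs (theta V f W1 D) = {x \<in> vecs W1. D x \<in> f ` vecs V}"
  by (simp add: theta_def)

lemma linear_map_theta:
  "linear_map W1 W g \<Longrightarrow> linear_map (theta V f W1 D) W g"
  by (simp add: theta_def linear_map_def)

text \<open>Because \<open>q\<close> is injective, \<open>q (D x)\<close> lies in the image under
  \<open>q\<close> of the range of \<open>f\<close> only if \<open>D x\<close> lies in that range.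
  The condition that cuts out \<open>theta\<close> therefore corresponds on both sides.\<close>

lemma isometric_isomorphism_theta:
  assumes p: "isometric_isomorphism V V' p" and q: "isometric_isomorphism W W' q"
    and r: "isometric_isomorphism W1 W1' r"
    and f: "linear_map V W f" and D: "linear_map W1 W D"
    and comm_f: "\<And>x. x \<in> vecs V \<Longrightarrow> q (f x) = f' (p x)"
    and comm_D: "\<And>x. x \<in> vecs W1 \<Longrightarrow> q (D x) = D' (r x)"
  shows "isometric_isomorphism (theta V f W1 D) (theta V' f' W1' D') r"
proof -
  have im: "p ` vecs V = vecs V'" "r ` vecs W1 = vecs W1'"
    and inj: "inj_on r (vecs W1)" "inj_on q (vecs W)"
    using p q r by (auto simp: isometric_isomorphism_def bij_betw_def)
  have f_in: "f ` vecs V \<subseteq> vecs W" and D_in: "\<And>x. x \<in> vecs W1 \<Longrightarrow> D x \<in> vecs W"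
    using f D by (auto simp: linear_map_def)
  have im_f: "f' ` vecs V' = q ` f ` vecs V" using comm_f by (simp add: image_image flip: im(1))
  have iff: "D' (r x) \<in> f' ` vecs V' \<longleftrightarrow> D x \<in> f ` vecs V" if "x \<in> vecs W1" for x
    unfolding im_f comm_D[OF that, symmetric]
    using inj_on_image_mem_iff[OF inj(2) D_in[OF that] f_in] .
  have "r ` vecs (theta V f W1 D) = {y \<in> r ` vecs W1. D' y \<in> f' ` vecs V'}"
    unfolding vecs_theta using iff by blast
  then have "bij_betw r (vecs (theta V f W1 D)) (vecs (theta V' f' W1' D'))"
    unfolding bij_betw_def im(2) by (auto simp: vecs_theta intro: inj_on_subset[OF inj(1)])
  moreover have "r x \<in> vecs (theta V' f' W1' D')" if "x \<in> vecs (theta V f W1 D)" for x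
    using calculation that by (auto simp: bij_betw_def)
  ultimately show ?thesis
    using r by (simp add: isometric_isomorphism_def linear_map_def) (simp add: theta_def)
qed

text \<open>Isolated because it has the same counterpart in the link for every
  \<open>n \<ge> 1\<close>, whereas the counterpart of the down part depends on whether
  \<open>n = 1\<close>.\<close>

definition up_laplacian where
  "up_laplacian V W f W1 D x =
     persistent_boundary V W f D (adjoint_map (theta V f W1 D) V (persistent_boundary V W f D) x)"

lemma persistent_laplacian_up_down:
  "persistent_laplacian V W f W1 D V0 d x =
     vadd V (up_laplacian V W f W1 D x) (adjoint_map V V0 d (d x))"
  by (simp add: persistent_laplacian_def up_laplacian_def Let_def)

lemma persistent_boundary_linear:
  assumes V: "coordinatized V B \<kappa>" and W: "coordinatized W C \<mu>"
    and f: "isometric_map V W f" and D: "linear_map W1 W D"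
  shows "linear_map W1 V (persistent_boundary V W f D)"
  unfolding persistent_boundary_def moore_penrose_isometric_map[OF V W f]
proof (rule linear_map_compose[OF D])
  show "linear_map W V (adjoint_map V W f)"
    using is_adjoint_adjoint_map[OF V W, of f] f
    by (simp add: is_adjoint_def isometric_map_def)
qed

lemma up_laplacian_closed:
  assumes V: "coordinatized V B \<kappa>" and W: "coordinatized W C \<mu>" and W1: "coordinatized W1 E \<nu>"
    and f: "isometric_map V W f" and D: "linear_map W1 W D" and x: "x \<in> vecs V"
  shows "up_laplacian V W f W1 D x \<in> vecs V"
proof -
  have fl: "linear_map V W f" using f by (simp add: isometric_map_def)
  have \<delta>: "linear_map W1 V (persistent_boundary V W f D)" by (rule persistent_boundary_linear[OF V W f D])
  have "adjoint_map (theta V f W1 D) V (persistent_boundary V W f D) x \<in> vecs (theta V f W1 D)"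
    using is_adjoint_adjoint_map[OF coordinatized_theta[OF V W W1 fl D] V linear_map_theta[OF \<delta>]] x
    by (simp add: is_adjoint_def linear_map_def)
  then show ?thesis
    using \<delta> by (simp add: up_laplacian_def linear_map_def vecs_theta)
qed

lemma up_laplacian_transport:
  assumes V: "coordinatized V B \<kappa>" and W: "coordinatized W C \<mu>" and W1: "coordinatized W1 E \<nu>"
    and V': "coordinatized V' B' \<kappa>'" and W': "coordinatized W' C' \<mu>'" and W1': "coordinatized W1' E' \<nu>'"
    and p: "isometric_isomorphism V V' p" and q: "isometric_isomorphism W W' q"
    and r: "isometric_isomorphism W1 W1' r"
    and f: "isometric_map V W f" and D: "linear_map W1 W D"
    and f': "isometric_map V' W' f'" and D': "linear_map W1' W' D'"
    and comm_f: "\<And>x. x \<in> vecs V \<Longrightarrow> q (f x) = f' (p x)"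
    and comm_D: "\<And>x. x \<in> vecs W1 \<Longrightarrow> q (D x) = D' (r x)"
    and x: "x \<in> vecs V"
  shows "p (up_laplacian V W f W1 D x) = up_laplacian V' W' f' W1' D' (p x)"
proof -
  let ?\<delta> = "persistent_boundary V W f D" and ?\<delta>' = "persistent_boundary V' W' f' D'"
  let ?T = "theta V f W1 D" and ?T' = "theta V' f' W1' D'"
  have fl: "linear_map V W f" "linear_map V' W' f'" using f f' by (auto simp: isometric_map_def)
  have \<delta>: "linear_map W1 V ?\<delta>" by (rule persistent_boundary_linear[OF V W f D])
  have \<delta>': "linear_map W1' V' ?\<delta>'" by (rule persistent_boundary_linear[OF V' W' f' D'])
  have T: "coordinatized ?T E \<nu>" by (rule coordinatized_theta[OF V W W1 fl(1) D])
  have T': "coordinatized ?T' E' \<nu>'" by (rule coordinatized_theta[OF V' W' W1' fl(2) D'])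
  have r_T: "isometric_isomorphism ?T ?T' r"
    by (rule isometric_isomorphism_theta[OF p q r fl(1) D comm_f comm_D])
  \<comment> \<open>Proved on all of \<open>W1\<close>, so that restricting to \<open>theta\<close>
    later costs nothing.\<close>
  have comm_\<delta>: "p (?\<delta> z) = ?\<delta>' (r z)" if "z \<in> vecs W1" for z
    using that D
    by (simp add: persistent_boundary_def moore_penrose_isometric_map[OF V W f]
        moore_penrose_isometric_map[OF V' W' f'] linear_map_def flip: comm_D)
      (rule adjoint_map_transport[OF V W fl(1) V' W' fl(2) p isometric_isomorphism_imp_map[OF q] comm_f],
       auto)
  let ?y = "adjoint_map ?T V ?\<delta> x"
  have "?y \<in> vecs ?T"
    using is_adjoint_adjoint_map[OF T V linear_map_theta[OF \<delta>]] x
    by (simp add: is_adjoint_def linear_map_def)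
  then have y: "?y \<in> vecs W1" by (simp add: vecs_theta)
  have "p (?\<delta> ?y) = ?\<delta>' (r ?y)" by (rule comm_\<delta>[OF y])
  \<comment> \<open>Here the roles change: \<open>r\<close> is the isomorphism on the source of the
    persistent boundary, \<open>p\<close> the one on its target.\<close>
  also have "r ?y = adjoint_map ?T' V' ?\<delta>' (p x)"
    by (rule adjoint_map_transport[OF T V linear_map_theta[OF \<delta>] T' V' linear_map_theta[OF \<delta>'] r_T
          isometric_isomorphism_imp_map[OF p] _ x]) (simp add: comm_\<delta> vecs_theta)
  finally show ?thesis by (simp add: up_laplacian_def)
qed

section \<open>Relative chain groups\<close>

lemma chain_space_simps [simp]:
  "vecs (chain_space K n) = {c. \<forall>\<sigma>. \<sigma> \<notin> simplices K n \<longrightarrow> c \<sigma> = 0}"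
  "vadd (chain_space K n) = (\<lambda>c d \<sigma>. c \<sigma> + d \<sigma>)"
  "vzero (chain_space K n) = (\<lambda>\<sigma>. 0)"
  "vscale (chain_space K n) = (\<lambda>r c \<sigma>. r * c \<sigma>)"
  "ip (chain_space K n) = (\<lambda>c d. \<Sum>\<sigma>\<in>simplices K n. c \<sigma> * d \<sigma>)"
  by (simp_all add: chain_space_def)

lemma finite_simplices: "finite K \<Longrightarrow> finite (simplices K n)"
  by (simp add: simplices_def)

lemma simplices_mono: "L \<subseteq> K \<Longrightarrow> simplices L n \<subseteq> simplices K n"
  by (auto simp: simplices_def)

lemma coordinatized_chain_space:
  "finite K \<Longrightarrow> coordinatized (chain_space K n) (simplices K n) (\<lambda>c. c)"
  by unfold_locales (auto simp: finite_simplices)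

lemma coordinatized_real_line: "coordinatized real_line {()} (\<lambda>x _. x)"
  by unfold_locales (auto simp: real_line_def inj_on_def fun_eq_iff)

text \<open>Holds for every function \<open>c\<close>, whether or not it is a chain of
  \<open>K\<close>, so the arithmetic of cosets carries no membership side conditions.\<close>

lemma rel_class_eq: "rel_class K L n c = {c'. \<forall>\<sigma>. \<sigma> \<notin> simplices L n \<longrightarrow> c' \<sigma> = c \<sigma>}"
proof (rule set_eqI)
  fix c' :: "'a set \<Rightarrow> real"
  have "c' = (\<lambda>\<sigma>. c \<sigma> + (c' \<sigma> - c \<sigma>))" by simp
  then show "c' \<in> rel_class K L n c \<longleftrightarrow> c' \<in> {c'. \<forall>\<sigma>. \<sigma> \<notin> simplices L n \<longrightarrow> c' \<sigma> = c \<sigma>}"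
    by (auto simp: rel_class_def quot_class_def intro!: exI[of _ "\<lambda>\<sigma>. c' \<sigma> - c \<sigma>"])
qed

lemma mem_rel_class: "d \<in> rel_class K L n c \<longleftrightarrow> (\<forall>\<sigma>. \<sigma> \<notin> simplices L n \<longrightarrow> d \<sigma> = c \<sigma>)"
  by (simp add: rel_class_eq)

lemma rel_class_eq_iff:
  "rel_class K L n c = rel_class K L n d \<longleftrightarrow> (\<forall>\<sigma>. \<sigma> \<notin> simplices L n \<longrightarrow> c \<sigma> = d \<sigma>)"
  by (auto simp: rel_class_eq set_eq_iff)

lemma vecs_rel_chains: "vecs (rel_chains K L n) = rel_class K L n ` vecs (chain_space K n)"
  by (simp add: rel_chains_def quotient_space_def rel_class_def)

lemma vadd_rel_class:
  "vadd (rel_chains K L n) (rel_class K L n c) (rel_class K L n d) = rel_class K L n (\<lambda>\<sigma>. c \<sigma> + d \<sigma>)"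
proof (rule set_eqI)
  fix e :: "'a set \<Rightarrow> real"
  have "e \<in> vadd (rel_chains K L n) (rel_class K L n c) (rel_class K L n d) \<longleftrightarrow>
      (\<exists>a b. e = (\<lambda>\<sigma>. a \<sigma> + b \<sigma>) \<and> a \<in> rel_class K L n c \<and> b \<in> rel_class K L n d)"
    by (simp add: rel_chains_def quotient_space_def)
  also have "\<dots> \<longleftrightarrow> e \<in> rel_class K L n (\<lambda>\<sigma>. c \<sigma> + d \<sigma>)"
  proof
    assume "e \<in> rel_class K L n (\<lambda>\<sigma>. c \<sigma> + d \<sigma>)"
    then show "\<exists>a b. e = (\<lambda>\<sigma>. a \<sigma> + b \<sigma>) \<and> a \<in> rel_class K L n c \<and> b \<in> rel_class K L n d"
      by (intro exI[of _ "\<lambda>\<sigma>. e \<sigma> - d \<sigma>"] exI[of _ d]) (simp add: mem_rel_class)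
  qed (auto simp: mem_rel_class)
  finally show "e \<in> vadd (rel_chains K L n) (rel_class K L n c) (rel_class K L n d) \<longleftrightarrow>
      e \<in> rel_class K L n (\<lambda>\<sigma>. c \<sigma> + d \<sigma>)" .
qed

lemma vscale_rel_class:
  "vscale (rel_chains K L n) r (rel_class K L n c) = rel_class K L n (\<lambda>\<sigma>. r * c \<sigma>)"
proof -
  have "(\<Union>a\<in>rel_class K L n c. rel_class K L n (\<lambda>\<sigma>. r * a \<sigma>)) = rel_class K L n (\<lambda>\<sigma>. r * c \<sigma>)"
  proof (rule SUP_eq_const)
    have "c \<in> rel_class K L n c" by (simp add: mem_rel_class)
    then show "rel_class K L n c \<noteq> {}" by blast
  qed (simp add: rel_class_eq_iff mem_rel_class)
  then show ?thesis
    by (simp add: rel_chains_def quotient_space_def rel_class_def)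
qed

text \<open>Orthogonality to the chains of \<open>L\<close>, tested on a single simplex, forces the
  coefficient there to vanish. \<open>L \<subseteq> K\<close> enters because the inner product sums
  over the simplices of \<open>K\<close>.\<close>

lemma orth_rep_rel_class:
  assumes "finite K" "L \<subseteq> K"
  shows "orth_rep (chain_space K n) (vecs (chain_space L n)) (rel_class K L n c) =
    (\<lambda>\<sigma>. if \<sigma> \<in> simplices L n then 0 else c \<sigma>)"
  unfolding orth_rep_def
proof (rule the_equality)
  let ?p = "\<lambda>\<sigma>. if \<sigma> \<in> simplices L n then 0 else c \<sigma>"
  show "?p \<in> rel_class K L n c \<and> (\<forall>u\<in>vecs (chain_space L n). ip (chain_space K n) ?p u = 0)"
    by (auto simp: mem_rel_class intro!: sum.neutral)
  fix a assume a: "a \<in> rel_class K L n c \<and> (\<forall>u\<in>vecs (chain_space L n). ip (chain_space K n) a u = 0)"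
  have "a \<sigma> = 0" if \<sigma>: "\<sigma> \<in> simplices L n" for \<sigma>
  proof -
    let ?u = "\<lambda>\<rho>. if \<rho> = \<sigma> then 1 else 0 :: real"
    have "?u \<in> vecs (chain_space L n)" using \<sigma> by auto
    then have "ip (chain_space K n) a ?u = 0" using a by blast
    moreover have "ip (chain_space K n) a ?u = a \<sigma>"
      using \<sigma> simplices_mono[OF assms(2)] finite_simplices[OF assms(1)]
      by (auto simp: if_distrib[of "\<lambda>x. _ * x"] sum.delta cong: if_cong)
    ultimately show ?thesis by simp
  qed
  then show "a = ?p" using a by (auto simp: mem_rel_class)
qed

lemma ip_rel_class:
  assumes "finite K" "L \<subseteq> K"
  shows "ip (rel_chains K L n) (rel_class K L n c) (rel_class K L n d) =
    (\<Sum>\<sigma>\<in>simplices K n - simplices L n. c \<sigma> * d \<sigma>)"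
proof -
  have "ip (rel_chains K L n) (rel_class K L n c) (rel_class K L n d) =
      (\<Sum>\<sigma>\<in>simplices K n. (if \<sigma> \<in> simplices L n then 0 else c \<sigma>) * (if \<sigma> \<in> simplices L n then 0 else d \<sigma>))"
    by (simp add: rel_chains_def quotient_space_def orth_rep_rel_class[OF assms, simplified])
  also have "\<dots> = (\<Sum>\<sigma>\<in>simplices K n - simplices L n. c \<sigma> * d \<sigma>)"
    by (rule sum.mono_neutral_cong_right) (auto simp: finite_simplices[OF assms(1)])
  finally show ?thesis .
qed

text \<open>The orthogonal representative itself serves as coordinate map: it is linear on cosets
  and supported on the simplices of \<open>K\<close> outside \<open>L\<close>.\<close>

lemma coordinatized_rel_chains:
  assumes "finite K" "L \<subseteq> K"
  shows "coordinatized (rel_chains K L n) (simplices K n - simplices L n)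
    (orth_rep (chain_space K n) (vecs (chain_space L n)))"
proof
  let ?\<kappa> = "orth_rep (chain_space K n) (vecs (chain_space L n))"
  let ?R = "rel_chains K L n"
  note \<kappa> = orth_rep_rel_class[OF assms]
  show "finite (simplices K n - simplices L n)" by (simp add: assms(1) finite_simplices)
  have "(\<lambda>\<sigma>. 0) \<in> vecs (chain_space K n)" by simp
  then show "vecs ?R \<noteq> {}" unfolding vecs_rel_chains by blast
  fix A assume "A \<in> vecs ?R"
  then obtain c where c: "c \<in> vecs (chain_space K n)" "A = rel_class K L n c"
    unfolding vecs_rel_chains by blast
  have "(\<lambda>\<sigma>. r * c \<sigma>) \<in> vecs (chain_space K n)" for r using c by simp
  then show "vscale ?R r A \<in> vecs ?R" for r
    unfolding c(2) vscale_rel_class vecs_rel_chains by blast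
  show "?\<kappa> (vscale ?R r A) = (\<lambda>b. r * ?\<kappa> A b)" for r
    unfolding c(2) vscale_rel_class \<kappa> by auto
  show "?\<kappa> A b = 0" if "b \<notin> simplices K n - simplices L n" for b
    unfolding c(2) \<kappa> using that c(1) by auto
  fix B assume "B \<in> vecs ?R"
  then obtain d where d: "d \<in> vecs (chain_space K n)" "B = rel_class K L n d"
    unfolding vecs_rel_chains by blast
  have "(\<lambda>\<sigma>. c \<sigma> + d \<sigma>) \<in> vecs (chain_space K n)" using c d by simp
  then show "vadd ?R A B \<in> vecs ?R"
    unfolding c(2) d(2) vadd_rel_class vecs_rel_chains by blast
  show "?\<kappa> (vadd ?R A B) = (\<lambda>b. ?\<kappa> A b + ?\<kappa> B b)"
    unfolding c(2) d(2) vadd_rel_class \<kappa> by auto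
  show "ip ?R A B = (\<Sum>b\<in>simplices K n - simplices L n. ?\<kappa> A b * ?\<kappa> B b)"
    unfolding c(2) d(2) ip_rel_class[OF assms] \<kappa> by (intro sum.cong) auto
next
  show "inj_on (orth_rep (chain_space K n) (vecs (chain_space L n))) (vecs (rel_chains K L n))"
  proof (rule inj_onI)
    fix A B
    assume "A \<in> vecs (rel_chains K L n)" "B \<in> vecs (rel_chains K L n)"
      and eq: "orth_rep (chain_space K n) (vecs (chain_space L n)) A =
        orth_rep (chain_space K n) (vecs (chain_space L n)) B"
    then obtain c d where cd: "A = rel_class K L n c" "B = rel_class K L n d"
      unfolding vecs_rel_chains by blast
    have "c \<sigma> = d \<sigma>" if "\<sigma> \<notin> simplices L n" for \<sigma>
      using fun_cong[OF eq, of \<sigma>] that unfolding cd orth_rep_rel_class[OF assms] by simp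
    then show "A = B" unfolding cd rel_class_eq_iff by blast
  qed
qed

lemma linear_map_rel_chains:
  assumes "\<And>c. c \<in> vecs (chain_space K n) \<Longrightarrow> F (rel_class K L n c) \<in> vecs W"
    and "\<And>c d. c \<in> vecs (chain_space K n) \<Longrightarrow> d \<in> vecs (chain_space K n) \<Longrightarrow>
      F (rel_class K L n (\<lambda>\<sigma>. c \<sigma> + d \<sigma>)) = vadd W (F (rel_class K L n c)) (F (rel_class K L n d))"
    and "\<And>r c. c \<in> vecs (chain_space K n) \<Longrightarrow>
      F (rel_class K L n (\<lambda>\<sigma>. r * c \<sigma>)) = vscale W r (F (rel_class K L n c))"
  shows "linear_map (rel_chains K L n) W F"
  unfolding linear_map_def vecs_rel_chains ball_simps vadd_rel_class vscale_rel_class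
  by (intro conjI allI ballI assms)

lemma isometric_map_rel_chains:
  assumes "finite K" "L \<subseteq> K" "linear_map (rel_chains K L n) W F"
    and "\<And>c d. c \<in> vecs (chain_space K n) \<Longrightarrow> d \<in> vecs (chain_space K n) \<Longrightarrow>
      ip W (F (rel_class K L n c)) (F (rel_class K L n d)) = (\<Sum>\<sigma>\<in>simplices K n - simplices L n. c \<sigma> * d \<sigma>)"
  shows "isometric_map (rel_chains K L n) W F"
  unfolding isometric_map_def vecs_rel_chains ball_simps ip_rel_class[OF assms(1,2)]
  using assms(3,4) by blast

lemma induced_map_rel_class:
  assumes "\<And>d. d \<in> rel_class K L n c \<Longrightarrow> f d \<in> rel_class K' L' m (f c)"
  shows "induced_map (chain_space K' m) (vecs (chain_space L' m)) f (rel_class K L n c) =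
    rel_class K' L' m (f c)"
  unfolding induced_map_def rel_class_def[symmetric]
proof (rule SUP_eq_const)
  have "c \<in> rel_class K L n c" by (simp add: mem_rel_class)
  then show "rel_class K L n c \<noteq> {}" by blast
  show "rel_class K' L' m (f d) = rel_class K' L' m (f c)" if "d \<in> rel_class K L n c" for d
    using assms[OF that] by (simp add: rel_class_eq_iff mem_rel_class)
qed

lemma rel_inclusion_rel_class:
  assumes "L \<subseteq> L'"
  shows "rel_inclusion K' L' n (rel_class K L n c) = rel_class K' L' n c"
  unfolding rel_inclusion_def
  using induced_map_rel_class[of K L n c inclusion K' L' n] simplices_mono[OF assms]
  by (auto simp: inclusion_def mem_rel_class)

section \<open>The boundary operator\<close>

lemma inversions_sorted: "sorted xs \<Longrightarrow> inversions xs = {}"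
  by (fastforce simp: inversions_def dest: sorted_nth_mono[OF _ less_imp_le])

text \<open>In the sorted list, position \<open>k\<close> holds the vertex with exactly
  \<open>k\<close> smaller ones, and deleting it leaves a sorted list without inversions. The
  resulting form is free of lists, so the effect of inserting \<open>v\<close> can be
  counted.\<close>

lemma boundary_simplex_sorted:
  assumes "finite \<sigma>"
  shows "boundary_simplex (sorted_list_of_set \<sigma>) \<tau> =
    (\<Sum>w\<in>\<sigma>. if \<tau> = \<sigma> - {w} then (- 1) ^ card {u\<in>\<sigma>. u < w} else 0)"
proof -
  define xs where "xs = sorted_list_of_set \<sigma>"
  have xs: "sorted xs" "distinct xs" "set xs = \<sigma>" using assms by (auto simp: xs_def)
  have summand: "(- 1) ^ k * oriented (drop_nth k xs) \<tau> =
      (if \<tau> = \<sigma> - {xs ! k} then (- 1) ^ card {u\<in>\<sigma>. u < xs ! k} else 0)" if k: "k < length xs" for k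
  proof -
    define as w bs where "as = take k xs" and "w = xs ! k" and "bs = drop (Suc k) xs"
    have dec: "xs = as @ w # bs" unfolding as_def w_def bs_def using k by (rule id_take_nth_drop)
    have drop: "drop_nth k xs = as @ bs" by (simp add: drop_nth_def as_def bs_def)
    have sorted: "sorted (as @ bs)" using xs(1) unfolding dec by (auto simp: sorted_append)
    have "set (as @ bs) = \<sigma> - {w}" using xs(2) by (auto simp: dec simp flip: xs(3))
    moreover have "{u\<in>\<sigma>. u < w} = set as"
      using xs(1,2) by (auto simp: dec sorted_append order.strict_iff_order simp flip: xs(3))
    moreover have "card (set as) = k"
      using xs(2) k by (simp add: as_def distinct_card)
    ultimately show ?thesis
      unfolding drop oriented_def inversions_sorted[OF sorted] w_def[symmetric] by simp
  qed
  have "boundary_simplex xs \<tau> = (\<Sum>k<length xs. if \<tau> = \<sigma> - {xs ! k} then (- 1) ^ card {u\<in>\<sigma>. u < xs ! k} else 0)"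
    unfolding boundary_simplex_def by (intro sum.cong) (auto simp: summand)
  also have "\<dots> = (\<Sum>w\<in>\<sigma>. if \<tau> = \<sigma> - {w} then (- 1) ^ card {u\<in>\<sigma>. u < w} else 0)"
    by (rule sum.reindex_bij_betw) (rule bij_betw_nth, use xs in auto)
  finally show ?thesis by (simp add: xs_def)
qed

lemma face_closed:
  "finite_simplicial_complex K \<Longrightarrow> \<sigma> \<in> K \<Longrightarrow> \<tau> \<subseteq> \<sigma> \<Longrightarrow> \<tau> \<noteq> {} \<Longrightarrow> \<tau> \<in> K"
  unfolding finite_simplicial_complex_def by blast

text \<open>The bound \<open>1 \<le> n\<close> excludes the empty face of a vertex, where the value
  is 1 rather than 0. That value reappears as the augmentation.\<close>

lemma boundary_simplex_eq_0:
  assumes K: "finite_simplicial_complex K" and "\<sigma> \<in> simplices K n" "1 \<le> n" "\<tau> \<notin> simplices K (n - 1)"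
  shows "boundary_simplex (sorted_list_of_set \<sigma>) \<tau> = 0"
proof -
  have \<sigma>: "\<sigma> \<in> K" "finite \<sigma>" "int (card \<sigma>) = n + 1"
    using K assms(2) by (auto simp: simplices_def finite_simplicial_complex_def)
  have "\<tau> \<noteq> \<sigma> - {w}" if "w \<in> \<sigma>" for w
  proof
    assume \<tau>: "\<tau> = \<sigma> - {w}"
    have "Suc (card \<tau>) = card \<sigma>" unfolding \<tau> by (rule card_Suc_Diff1[OF \<sigma>(2) that])
    then have card: "int (card \<tau>) = n" using \<sigma>(3) by simp
    have "\<tau> \<noteq> {}"
    proof
      assume "\<tau> = {}"
      then show False using card assms(3) by simp
    qed
    moreover have "\<tau> \<subseteq> \<sigma>" using \<tau> by blast
    ultimately have "\<tau> \<in> K" by (rule face_closed[OF K \<sigma>(1), rotated])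
    then show False using card assms(4) by (simp add: simplices_def)
  qed
  then show ?thesis by (simp add: boundary_simplex_sorted[OF \<sigma>(2)])
qed

lemma linear_map_boundary:
  assumes "finite_simplicial_complex K"
  shows "linear_map (chain_space K n) (chain_space K (n - 1)) (boundary K n)"
  unfolding linear_map_def chain_space_simps mem_Collect_eq
proof (intro conjI ballI allI impI ext)
  fix c d :: "'a set \<Rightarrow> real" and r \<tau>
  show "boundary K n c \<tau> = 0" if "\<tau> \<notin> simplices K (n - 1)"
    using that boundary_simplex_eq_0[OF assms] by (simp add: boundary_def)
  show "boundary K n (\<lambda>\<sigma>. c \<sigma> + d \<sigma>) \<tau> = boundary K n c \<tau> + boundary K n d \<tau>"
    by (simp add: boundary_def distrib_right sum.distrib)
  show "boundary K n (\<lambda>\<sigma>. r * c \<sigma>) \<tau> = r * boundary K n c \<tau>"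
    by (simp add: boundary_def sum_distrib_left mult.assoc)
qed

text \<open>Members of a coset differ only on simplices of \<open>L\<close>, whose faces stay in
  \<open>L\<close>; this is why \<open>L\<close> has to be a complex.\<close>

lemma rel_boundary_rel_class:
  assumes L: "finite_simplicial_complex L" and K: "finite K" and "L \<subseteq> K"
  shows "rel_boundary K L n (rel_class K L n c) = rel_class K L (n - 1) (boundary K n c)"
  unfolding rel_boundary_def
proof (rule induced_map_rel_class)
  fix d assume d: "d \<in> rel_class K L n c"
  have "d \<sigma> * boundary_simplex (sorted_list_of_set \<sigma>) \<tau> = c \<sigma> * boundary_simplex (sorted_list_of_set \<sigma>) \<tau>"
    if "1 \<le> n" "\<tau> \<notin> simplices L (n - 1)" for \<sigma> \<tau>
    using d boundary_simplex_eq_0[OF L _ that] by (cases "\<sigma> \<in> simplices L n") (auto simp: mem_rel_class)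
  then show "boundary K n d \<in> rel_class K L (n - 1) (boundary K n c)"
    by (auto simp: mem_rel_class boundary_def intro!: sum.cong)
qed

lemma linear_map_rel_boundary:
  assumes K: "finite_simplicial_complex K" and L: "finite_simplicial_complex L" and LK: "L \<subseteq> K"
  shows "linear_map (rel_chains K L n) (rel_chains K L (n - 1)) (rel_boundary K L n)"
proof -
  have fin: "finite K" using K by (simp add: finite_simplicial_complex_def)
  note bd = rel_boundary_rel_class[OF L fin LK, of n]
  note lin = linear_map_boundary[OF K, of n, unfolded linear_map_def]
  show ?thesis
  proof (rule linear_map_rel_chains)
    fix c d :: "'a set \<Rightarrow> real" and r
    assume c: "c \<in> vecs (chain_space K n)"
    then show "rel_boundary K L n (rel_class K L n c) \<in> vecs (rel_chains K L (n - 1))"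
      using lin unfolding bd vecs_rel_chains by blast
    show "rel_boundary K L n (rel_class K L n (\<lambda>\<sigma>. r * c \<sigma>)) =
        vscale (rel_chains K L (n - 1)) r (rel_boundary K L n (rel_class K L n c))"
      using lin c unfolding bd vscale_rel_class by simp
    assume "d \<in> vecs (chain_space K n)"
    then show "rel_boundary K L n (rel_class K L n (\<lambda>\<sigma>. c \<sigma> + d \<sigma>)) =
        vadd (rel_chains K L (n - 1)) (rel_boundary K L n (rel_class K L n c)) (rel_boundary K L n (rel_class K L n d))"
      using lin c unfolding bd vadd_rel_class by simp
  qed
qed

section \<open>The link isomorphism\<close>

lemma finite_simplicial_complex_antistar:
  "finite_simplicial_complex K \<Longrightarrow> finite_simplicial_complex (antistar K v)"
  unfolding finite_simplicial_complex_def antistar_def by (simp, blast)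

lemma antistar_subset: "antistar K v \<subseteq> K"
  by (auto simp: antistar_def)

lemma antistar_mono: "K \<subseteq> K' \<Longrightarrow> antistar K v \<subseteq> antistar K' v"
  by (auto simp: antistar_def)

lemma finite_simplicial_complex_link:
  assumes "finite_simplicial_complex K"
  shows "finite_simplicial_complex (link K v)"
  unfolding finite_simplicial_complex_def
proof (intro conjI ballI allI impI)
  show "finite (link K v)" using assms by (simp add: finite_simplicial_complex_def link_def)
  fix \<sigma> assume \<sigma>: "\<sigma> \<in> link K v"
  then show "finite \<sigma>" "\<sigma> \<noteq> {}" using assms by (auto simp: finite_simplicial_complex_def link_def)
  fix \<tau> assume \<tau>: "\<tau> \<subseteq> \<sigma> \<and> \<tau> \<noteq> {}"
  have \<sigma>': "\<sigma> \<in> K" "v \<notin> \<sigma>" "\<sigma> \<union> {v} \<in> K" using \<sigma> by (auto simp: link_def)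
  have "\<tau> \<in> K" using \<tau> by (intro face_closed[OF assms \<sigma>'(1)]) auto
  moreover have "\<tau> \<union> {v} \<in> K" using \<tau> by (intro face_closed[OF assms \<sigma>'(3)]) auto
  ultimately show "\<tau> \<in> link K v" using \<tau> \<sigma>'(2) by (auto simp: link_def)
qed

lemma link_mono: "K \<subseteq> K' \<Longrightarrow> link K v \<subseteq> link K' v"
  by (auto simp: link_def)

text \<open>\<open>{v}\<close> is a face of \<open>\<sigma> \<union> {v}\<close>, so before the
  birth of \<open>v\<close> the link is empty anyway and the case distinction disappears.\<close>

lemma persistent_link_eq:
  assumes "finite_simplicial_complex (K i)"
  shows "persistent_link K v i = link (K i) v"
proof -
  have "{v} \<in> K i" if "\<sigma> \<union> {v} \<in> K i" for \<sigma>
    by (rule face_closed[OF assms that]) auto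
  then show ?thesis by (auto simp: persistent_link_def link_def)
qed

text \<open>For \<open>n = 0\<close> the simplex \<open>{v}\<close> would lose its only vertex, and
  the empty set is not a simplex; this is where degree 0 parts company.\<close>

lemma bij_betw_insert_link:
  assumes K: "finite_simplicial_complex K" and "1 \<le> n"
  shows "bij_betw (insert v) (simplices (link K v) (n - 1)) (simplices K n - simplices (antistar K v) n)"
proof (rule bij_betw_byWitness[where f' = "\<lambda>\<sigma>. \<sigma> - {v}"])
  have fin: "finite \<sigma>" if "\<sigma> \<in> K" for \<sigma> using K that by (simp add: finite_simplicial_complex_def)
  show "\<forall>\<tau>\<in>simplices (link K v) (n - 1). insert v \<tau> - {v} = \<tau>"
    by (auto simp: simplices_def link_def)
  show "\<forall>\<sigma>\<in>simplices K n - simplices (antistar K v) n. insert v (\<sigma> - {v}) = \<sigma>"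
    by (auto simp: simplices_def antistar_def)
  show "insert v ` simplices (link K v) (n - 1) \<subseteq> simplices K n - simplices (antistar K v) n"
    using fin by (auto simp: simplices_def link_def antistar_def)
  show "(\<lambda>\<sigma>. \<sigma> - {v}) ` (simplices K n - simplices (antistar K v) n) \<subseteq> simplices (link K v) (n - 1)"
  proof (rule image_subsetI)
    fix \<sigma> assume "\<sigma> \<in> simplices K n - simplices (antistar K v) n"
    then have \<sigma>: "\<sigma> \<in> K" "v \<in> \<sigma>" "int (card \<sigma>) = n + 1" by (auto simp: simplices_def antistar_def)
    have "Suc (card (\<sigma> - {v})) = card \<sigma>" by (rule card_Suc_Diff1[OF fin[OF \<sigma>(1)] \<sigma>(2)])
    then have card: "int (card (\<sigma> - {v})) = n" using \<sigma>(3) by linarith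
    then have "\<sigma> - {v} \<noteq> {}" using assms(2) by (metis card.empty of_nat_0 not_one_le_zero)
    then have "\<sigma> - {v} \<in> K" by (intro face_closed[OF K \<sigma>(1)]) auto
    then show "\<sigma> - {v} \<in> simplices (link K v) (n - 1)"
      using \<sigma> card by (auto simp: simplices_def link_def insert_absorb)
  qed
qed

lemma simplices_linkD:
  assumes "finite_simplicial_complex K" "\<tau> \<in> simplices (link K v) n"
  shows "finite \<tau>" "v \<notin> \<tau>"
  using assms by (auto simp: simplices_def link_def finite_simplicial_complex_def)

text \<open>\<open>n\<close> is the degree on the relative side, one above the dimension of
  \<open>\<tau>\<close>.\<close>

definition link_sign :: "'a::linorder \<Rightarrow> int \<Rightarrow> 'a set \<Rightarrow> real" where
  "link_sign v n \<tau> = (- 1) ^ nat n * (- 1) ^ card {w\<in>\<tau>. w < v}"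

lemma link_sign_square [simp]: "link_sign v n \<tau> * link_sign v n \<tau> = 1"
  by (simp add: link_sign_def power_mult_distrib[symmetric] flip: power_add mult_2)

text \<open>Exactly one sign flips for each vertex \<open>w\<close> of \<open>\<rho>\<close>: if
  \<open>v < w\<close>, inserting \<open>v\<close> puts one more vertex below \<open>w\<close>; if
  \<open>w < v\<close>, deleting \<open>w\<close> leaves one vertex fewer below \<open>v\<close>.
  Passing from \<open>n\<close> to \<open>n + 1\<close> in \<open>link_sign\<close>
  compensates.\<close>

lemma link_sign_boundary:
  assumes "finite \<rho>" "v \<notin> \<rho>" "v \<notin> \<tau>" "0 \<le> n"
  shows "link_sign v n \<tau> * boundary_simplex (sorted_list_of_set (insert v \<rho>)) (insert v \<tau>) =
    link_sign v (n + 1) \<rho> * boundary_simplex (sorted_list_of_set \<rho>) \<tau>"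
proof -
  have sign: "link_sign v n (\<rho> - {w}) * (- 1) ^ card {u\<in>insert v \<rho>. u < w} =
      link_sign v (n + 1) \<rho> * (- 1) ^ card {u\<in>\<rho>. u < w}" if w: "w \<in> \<rho>" for w
  proof -
    have n: "nat (n + 1) = Suc (nat n)" using assms(4) by simp
    show ?thesis
    proof (cases "v < w")
      case True
      have "{u\<in>insert v \<rho>. u < w} = insert v {u\<in>\<rho>. u < w}" using True by auto
      moreover have "{u\<in>\<rho> - {w}. u < v} = {u\<in>\<rho>. u < v}" using True by auto
      ultimately show ?thesis using assms by (simp add: link_sign_def n)
    next
      case False
      then have "w < v" using w assms(2) by (metis linorder_neqE)
      then have "{u\<in>\<rho>. u < v} = insert w {u\<in>\<rho> - {w}. u < v}" using w by auto
      moreover have "{u\<in>insert v \<rho>. u < w} = {u\<in>\<rho>. u < w}" using False by auto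
      ultimately show ?thesis using assms by (simp add: link_sign_def n)
    qed
  qed
  have "boundary_simplex (sorted_list_of_set (insert v \<rho>)) (insert v \<tau>) =
    (\<Sum>w\<in>insert v \<rho>. if insert v \<tau> = insert v \<rho> - {w} then (- 1) ^ card {u\<in>insert v \<rho>. u < w} else 0)"
    by (rule boundary_simplex_sorted) (simp add: assms(1))
  \<comment> \<open>The face opposite \<open>v\<close> does not contain \<open>v\<close>, so it
    never equals \<open>insert v \<tau>\<close>.\<close>
  also have "\<dots> = (\<Sum>w\<in>\<rho>. if \<tau> = \<rho> - {w} then (- 1) ^ card {u\<in>insert v \<rho>. u < w} else 0)"
  proof (rule sum.mono_neutral_cong_right)
    show "\<forall>w\<in>insert v \<rho> - \<rho>. (if insert v \<tau> = insert v \<rho> - {w}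
        then (- 1) ^ card {u\<in>insert v \<rho>. u < w} else 0) = (0 :: real)"
    proof
      fix w assume "w \<in> insert v \<rho> - \<rho>"
      then have "w = v" by blast
      then have "insert v \<tau> \<noteq> insert v \<rho> - {w}" by blast
      then show "(if insert v \<tau> = insert v \<rho> - {w}
        then (- 1) ^ card {u\<in>insert v \<rho>. u < w} else 0) = (0 :: real)" by (rule if_not_P)
    qed
    fix w assume "w \<in> \<rho>"
    then have "insert v \<rho> - {w} = insert v (\<rho> - {w})" using assms(2) by (auto simp: insert_Diff_if)
    then have "insert v \<tau> = insert v \<rho> - {w} \<longleftrightarrow> \<tau> = \<rho> - {w}"
      using assms(2,3) by (simp add: insert_ident)
    then show "(if insert v \<tau> = insert v \<rho> - {w} then (- 1) ^ card {u\<in>insert v \<rho>. u < w} else 0) =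
        (if \<tau> = \<rho> - {w} then (- 1) ^ card {u\<in>insert v \<rho>. u < w} else (0 :: real))" by simp
  qed (use assms(1) in auto)
  finally show ?thesis
    unfolding boundary_simplex_sorted[OF assms(1)]
    by (simp only: sum_distrib_left) (intro sum.cong refl, use sign in simp)
qed

text \<open>\<open>SOME\<close> is harmless here: members of a coset modulo the antistar agree on simplices containing \<open>v\<close>.\<close>

definition link_iso :: "'a::linorder set set \<Rightarrow> 'a \<Rightarrow> int \<Rightarrow> ('a set \<Rightarrow> real) set \<Rightarrow> 'a set \<Rightarrow> real" where
  "link_iso K v n A = (\<lambda>\<tau>. if \<tau> \<in> simplices (link K v) (n - 1)
     then link_sign v n \<tau> * (SOME a. a \<in> A) (insert v \<tau>) else 0)"

lemma some_rel_class_antistar: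
  assumes "v \<in> \<sigma>"
  shows "(SOME a. a \<in> rel_class K (antistar K v) n c) \<sigma> = c \<sigma>"
proof -
  have "c \<in> rel_class K (antistar K v) n c" by (simp add: mem_rel_class)
  then have "(SOME a. a \<in> rel_class K (antistar K v) n c) \<in> rel_class K (antistar K v) n c"
    unfolding some_in_eq by blast
  then show ?thesis using assms by (auto simp: mem_rel_class simplices_def antistar_def)
qed

lemma link_iso_rel_class:
  "link_iso K v n (rel_class K (antistar K v) n c) =
    (\<lambda>\<tau>. if \<tau> \<in> simplices (link K v) (n - 1) then link_sign v n \<tau> * c (insert v \<tau>) else 0)"
  unfolding link_iso_def some_rel_class_antistar[OF insertI1] ..

text \<open>Inserting \<open>v\<close> matches the link simplices with the simplices spanning the
  relative chains, so orthonormal bases correspond up to signs.\<close>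

lemma isometric_isomorphism_link_iso:
  assumes K: "finite_simplicial_complex K" and n: "1 \<le> n"
  shows "isometric_isomorphism (rel_chains K (antistar K v) n) (chain_space (link K v) (n - 1)) (link_iso K v n)"
proof -
  let ?A = "antistar K v" and ?S = "simplices (link K v) (n - 1)"
  have fin: "finite K" using K by (simp add: finite_simplicial_complex_def)
  note bij = bij_betw_insert_link[OF K n, of v]
  have lin: "linear_map (rel_chains K ?A n) (chain_space (link K v) (n - 1)) (link_iso K v n)"
    by (rule linear_map_rel_chains) (auto simp: link_iso_rel_class fun_eq_iff algebra_simps)
  have "ip (chain_space (link K v) (n - 1)) (link_iso K v n (rel_class K ?A n c)) (link_iso K v n (rel_class K ?A n d)) =
      (\<Sum>\<sigma>\<in>simplices K n - simplices ?A n. c \<sigma> * d \<sigma>)" for c d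
  proof -
    have "link_sign v n \<tau> * x * (link_sign v n \<tau> * y) = x * y" for \<tau> x y
      using link_sign_square[of v n \<tau>] by (metis mult.assoc mult.left_commute mult_1)
    then show ?thesis
      unfolding link_iso_rel_class sum.reindex_bij_betw[OF bij, symmetric] chain_space_simps
      by (intro sum.cong refl) (simp only: if_True)
  qed
  then have iso: "isometric_map (rel_chains K ?A n) (chain_space (link K v) (n - 1)) (link_iso K v n)"
    by (rule isometric_map_rel_chains[OF fin antistar_subset lin])
  have "inj_on (link_iso K v n) (vecs (rel_chains K ?A n))"
  proof (rule inj_onI)
    fix A B assume "A \<in> vecs (rel_chains K ?A n)" "B \<in> vecs (rel_chains K ?A n)"
      and eq: "link_iso K v n A = link_iso K v n B"
    then obtain c d where cd: "c \<in> vecs (chain_space K n)" "A = rel_class K ?A n c"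
      "d \<in> vecs (chain_space K n)" "B = rel_class K ?A n d"
      unfolding vecs_rel_chains by blast
    have "c \<sigma> = d \<sigma>" if \<sigma>: "\<sigma> \<notin> simplices ?A n" for \<sigma>
    proof (cases "\<sigma> \<in> simplices K n")
      case True
      then obtain \<tau> where \<tau>: "\<tau> \<in> ?S" "\<sigma> = insert v \<tau>"
        using \<sigma> bij unfolding bij_betw_def by blast
      have "link_sign v n \<tau> * c \<sigma> = link_sign v n \<tau> * d \<sigma>"
        using fun_cong[OF eq, of \<tau>] \<tau> by (simp add: cd link_iso_rel_class)
      moreover have "link_sign v n \<tau> \<noteq> 0" by (simp add: link_sign_def)
      ultimately show ?thesis by simp
    qed (use cd in auto)
    then show "A = B" by (simp add: cd rel_class_eq_iff)
  qed
  moreover have "e \<in> link_iso K v n ` vecs (rel_chains K ?A n)"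
    if e: "e \<in> vecs (chain_space (link K v) (n - 1))" for e
  proof -
    \<comment> \<open>The preimage carries the same sign as the map, since each sign is its own
      inverse.\<close>
    define c where "c \<sigma> = (if \<sigma> \<in> simplices K n \<and> v \<in> \<sigma> then link_sign v n (\<sigma> - {v}) * e (\<sigma> - {v}) else 0)" for \<sigma>
    have c: "c \<in> vecs (chain_space K n)" by (simp add: c_def)
    have "link_iso K v n (rel_class K ?A n c) \<tau> = e \<tau>" for \<tau>
    proof (cases "\<tau> \<in> ?S")
      case True
      then have "insert v \<tau> \<in> simplices K n" using bij_betwE[OF bij] by blast
      moreover have "insert v \<tau> - {v} = \<tau>" using simplices_linkD(2)[OF K True] by auto
      ultimately show ?thesis
        using True link_sign_square[of v n \<tau>] by (simp add: link_iso_rel_class c_def mult.assoc[symmetric])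
    qed (use e in \<open>simp add: link_iso_rel_class\<close>)
    then have "e = link_iso K v n (rel_class K ?A n c)" by auto
    then show ?thesis using c unfolding vecs_rel_chains by blast
  qed
  ultimately have "bij_betw (link_iso K v n) (vecs (rel_chains K ?A n)) (vecs (chain_space (link K v) (n - 1)))"
    using lin unfolding bij_betw_def linear_map_def by blast
  then show ?thesis
    using iso by (simp add: isometric_isomorphism_def isometric_map_def)
qed

text \<open>Stated for any \<open>\<tau>\<close> avoiding \<open>v\<close> and down to
  \<open>n = 0\<close>, so that \<open>\<tau> = {}\<close> is covered; that instance produces the
  augmentation.\<close>

lemma link_sign_boundary_chain:
  assumes K: "finite_simplicial_complex K" and "0 \<le> n" "v \<notin> \<tau>"
  shows "link_sign v n \<tau> * boundary K (n + 1) c (insert v \<tau>) =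
    (\<Sum>\<rho>\<in>simplices (link K v) n. link_sign v (n + 1) \<rho> * c (insert v \<rho>) * boundary_simplex (sorted_list_of_set \<rho>) \<tau>)"
proof -
  let ?A = "antistar K v"
  have fin: "finite (simplices K (n + 1))"
    using K by (simp add: finite_simplicial_complex_def finite_simplices)
  \<comment> \<open>The antistar is itself a complex, so its simplices have no face containing
    \<open>v\<close>.\<close>
  have "boundary_simplex (sorted_list_of_set \<sigma>) (insert v \<tau>) = 0" if "\<sigma> \<in> simplices ?A (n + 1)" for \<sigma>
    by (rule boundary_simplex_eq_0[OF finite_simplicial_complex_antistar[OF K] that])
      (use assms in \<open>auto simp: simplices_def antistar_def\<close>)
  then have "boundary K (n + 1) c (insert v \<tau>) =
      (\<Sum>\<sigma>\<in>simplices K (n + 1) - simplices ?A (n + 1). c \<sigma> * boundary_simplex (sorted_list_of_set \<sigma>) (insert v \<tau>))"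
    using assms(2) fin unfolding boundary_def
    by (simp, intro sum.mono_neutral_right) auto
  also have "\<dots> = (\<Sum>\<rho>\<in>simplices (link K v) n. c (insert v \<rho>) *
      boundary_simplex (sorted_list_of_set (insert v \<rho>)) (insert v \<tau>))"
    using bij_betw_insert_link[OF K, of "n + 1" v] assms(2)
    by (simp add: sum.reindex_bij_betw[symmetric])
  finally show ?thesis
    using link_sign_boundary[of _ v \<tau> n] simplices_linkD[OF K, of _ v n] assms(2,3)
    by (auto simp: sum_distrib_left mult.left_commute[of "link_sign v n \<tau>"] mult.commute mult.left_commute
        intro!: sum.cong)
qed

text \<open>The square from relative degree 1 to 0 lies outside: there \<open>link_iso\<close> would
  be zero, hence no longer isometric once \<open>v\<close> is born.
  \<open>vertex_coefficient_rel_boundary\<close> takes its place.\<close>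

lemma link_iso_rel_boundary:
  assumes K: "finite_simplicial_complex K" and n: "1 \<le> n" and A: "A \<in> vecs (rel_chains K (antistar K v) (n + 1))"
  shows "link_iso K v n (rel_boundary K (antistar K v) (n + 1) A) = boundary (link K v) n (link_iso K v (n + 1) A)"
proof
  fix \<tau>
  let ?A = "antistar K v"
  have fin: "finite K" using K by (simp add: finite_simplicial_complex_def)
  obtain c where c: "A = rel_class K ?A (n + 1) c"
    using A unfolding vecs_rel_chains by blast
  have bd: "rel_boundary K ?A (n + 1) A = rel_class K ?A n (boundary K (n + 1) c)"
    using rel_boundary_rel_class[OF finite_simplicial_complex_antistar[OF K, of v] fin antistar_subset, of "n + 1" c]
    by (simp add: c)
  show "link_iso K v n (rel_boundary K ?A (n + 1) A) \<tau> = boundary (link K v) n (link_iso K v (n + 1) A) \<tau>"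
  proof (cases "\<tau> \<in> simplices (link K v) (n - 1)")
    case True
    then have "v \<notin> \<tau>" by (rule simplices_linkD(2)[OF K])
    then have "link_iso K v n (rel_boundary K ?A (n + 1) A) \<tau> =
        (\<Sum>\<rho>\<in>simplices (link K v) n. link_sign v (n + 1) \<rho> * c (insert v \<rho>) * boundary_simplex (sorted_list_of_set \<rho>) \<tau>)"
      using True n link_sign_boundary_chain[OF K, of n v \<tau> c] by (simp add: bd link_iso_rel_class)
    also have "\<dots> = boundary (link K v) n (link_iso K v (n + 1) A) \<tau>"
      using n unfolding c link_iso_rel_class by (auto simp: boundary_def intro!: sum.cong)
    finally show ?thesis .
  next
    case False
    then show ?thesis
      using n boundary_simplex_eq_0[OF finite_simplicial_complex_link[OF K, of v]]
      by (auto simp: bd link_iso_rel_class boundary_def intro!: sum.neutral)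
  qed
qed

text \<open>If \<open>\<tau>\<close> enters the link only in \<open>K'\<close>, then
  \<open>insert v \<tau>\<close> is not in \<open>K\<close>: otherwise its face
  \<open>\<tau>\<close> would be in \<open>K\<close> too, and hence already in the link. A chain of
  \<open>K\<close> therefore has coefficient 0 there.\<close>

lemma link_iso_rel_inclusion:
  assumes K: "finite_simplicial_complex K" and "K \<subseteq> K'" "1 \<le> n"
    and A: "A \<in> vecs (rel_chains K (antistar K v) n)"
  shows "link_iso K' v n (rel_inclusion K' (antistar K' v) n A) = inclusion (link_iso K v n A)"
proof -
  obtain c where c: "c \<in> vecs (chain_space K n)" "A = rel_class K (antistar K v) n c"
    using A unfolding vecs_rel_chains by blast
  have "c (insert v \<tau>) = 0"
    if \<tau>: "\<tau> \<in> simplices (link K' v) (n - 1)" "\<tau> \<notin> simplices (link K v) (n - 1)" for \<tau>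
  proof -
    have "\<tau> \<noteq> {}" "v \<notin> \<tau>" using \<tau>(1) assms(3) by (auto simp: simplices_def link_def)
    then have "\<tau> \<in> link K v" if "insert v \<tau> \<in> K"
      using face_closed[OF K that, of \<tau>] that by (auto simp: link_def)
    then have "insert v \<tau> \<notin> simplices K n" using \<tau> by (auto simp: simplices_def)
    then show ?thesis using c(1) by simp
  qed
  moreover have "simplices (link K v) (n - 1) \<subseteq> simplices (link K' v) (n - 1)"
    by (intro simplices_mono link_mono assms)
  ultimately show ?thesis
    unfolding c(2) rel_inclusion_rel_class[OF antistar_mono[OF assms(2)]] link_iso_rel_class
    by (auto simp: inclusion_def fun_eq_iff)
qed

section \<open>Values on oriented simplices\<close>

lemma card_inversions_Cons:
  assumes "distinct xs"
  shows "card (inversions (x # xs)) = card {w\<in>set xs. w < x} + card (inversions xs)"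
proof -
  let ?Q = "{q. q < length xs \<and> xs ! q < x}"
  have eq: "inversions (x # xs) = (\<lambda>q. (0, Suc q)) ` ?Q \<union> map_prod Suc Suc ` inversions xs"
    (is "_ = ?A \<union> ?B")
  proof (rule set_eqI, rule prod.induct)
    fix p q
    show "(p, q) \<in> inversions (x # xs) \<longleftrightarrow> (p, q) \<in> ?A \<union> ?B"
      by (cases p; cases q) (auto simp: inversions_def)
  qed
  have "inversions xs \<subseteq> {..<length xs} \<times> {..<length xs}" by (auto simp: inversions_def)
  then have fin: "finite (inversions xs)" by (rule finite_subset) simp
  have "{w\<in>set xs. w < x} = (!) xs ` ?Q" by (auto simp: in_set_conv_nth)
  then have "card {w\<in>set xs. w < x} = card ?Q"
    by (simp add: card_image inj_on_nth[OF assms])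
  moreover have "card ?A = card ?Q" by (simp add: card_image inj_on_def)
  moreover have "card ?B = card (inversions xs)" by (intro card_image) (auto simp: inj_on_def)
  moreover have "card (?A \<union> ?B) = card ?A + card ?B"
    using fin by (intro card_Un_disjoint) auto
  ultimately show ?thesis unfolding eq by simp
qed

text \<open>The number of vertices below \<open>v\<close> enters twice, through
  \<open>link_sign\<close> and through the inversions caused by \<open>v\<close> in front. The two
  signs cancel and leave the factor of the degree.\<close>

lemma link_iso_oriented:
  assumes K: "finite_simplicial_complex K" and ws: "distinct (v # ws)" "int (length ws) = n" "1 \<le> n"
    and \<sigma>: "set (v # ws) \<in> K"
  shows "link_iso K v n (rel_class K (antistar K v) n (oriented (v # ws))) = (\<lambda>\<sigma>. (- 1) ^ nat n * oriented ws \<sigma>)"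
proof
  fix \<tau>
  have "set ws \<noteq> {}" using ws by auto
  then have "set ws \<in> K" by (intro face_closed[OF K \<sigma>]) auto
  then have ws_link: "set ws \<in> simplices (link K v) (n - 1)"
    using ws \<sigma> by (simp add: simplices_def link_def distinct_card)
  have "link_iso K v n (rel_class K (antistar K v) n (oriented (v # ws))) \<tau> =
      (if \<tau> \<in> simplices (link K v) (n - 1) then link_sign v n \<tau> * oriented (v # ws) (insert v \<tau>) else 0)"
    by (simp only: link_iso_rel_class)
  also have "\<dots> = (- 1) ^ nat n * oriented ws \<tau>"
  proof (cases "\<tau> \<in> simplices (link K v) (n - 1)")
    case True
    then have "v \<notin> \<tau>" by (rule simplices_linkD(2)[OF K])
    then have iff: "insert v \<tau> = set (v # ws) \<longleftrightarrow> \<tau> = set ws"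
      using ws(1) by (simp add: insert_ident)
    have "link_sign v n (set ws) * (- 1) ^ card (inversions (v # ws)) = (- 1) ^ nat n * (- 1) ^ card (inversions ws)"
      using card_inversions_Cons[of ws v] ws(1) link_sign_square
      by (simp add: link_sign_def power_add)
    then show ?thesis using True iff by (simp add: oriented_def)
  next
    case False
    then have "\<tau> \<noteq> set ws" using ws_link by auto
    with False show ?thesis by (simp add: oriented_def)
  qed
  finally show "link_iso K v n (rel_class K (antistar K v) n (oriented (v # ws))) \<tau> = (- 1) ^ nat n * oriented ws \<tau>" .
qed

section \<open>Transition maps as isometric embeddings\<close>

lemma linear_map_rel_inclusion:
  assumes "K \<subseteq> K'" "L \<subseteq> L'"
  shows "linear_map (rel_chains K L n) (rel_chains K' L' n) (rel_inclusion K' L' n)"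
proof (rule linear_map_rel_chains)
  note incl = rel_inclusion_rel_class[OF assms(2)]
  fix c d :: "'a set \<Rightarrow> real" and r
  assume "c \<in> vecs (chain_space K n)"
  then have "c \<in> vecs (chain_space K' n)" using simplices_mono[OF assms(1), of n] by auto
  then show "rel_inclusion K' L' n (rel_class K L n c) \<in> vecs (rel_chains K' L' n)"
    unfolding incl vecs_rel_chains by (rule imageI)
  show "rel_inclusion K' L' n (rel_class K L n (\<lambda>\<sigma>. r * c \<sigma>)) =
      vscale (rel_chains K' L' n) r (rel_inclusion K' L' n (rel_class K L n c))"
    unfolding incl vscale_rel_class ..
  show "rel_inclusion K' L' n (rel_class K L n (\<lambda>\<sigma>. c \<sigma> + d \<sigma>)) =
      vadd (rel_chains K' L' n) (rel_inclusion K' L' n (rel_class K L n c)) (rel_inclusion K' L' n (rel_class K L n d))"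
    unfolding incl vadd_rel_class ..
qed

lemma isometric_map_inclusion:
  assumes "finite K'" "K \<subseteq> K'"
  shows "isometric_map (chain_space K n) (chain_space K' n) inclusion"
proof -
  have sub: "simplices K n \<subseteq> simplices K' n" by (rule simplices_mono[OF assms(2)])
  have "(\<Sum>\<sigma>\<in>simplices K' n. c \<sigma> * d \<sigma>) = (\<Sum>\<sigma>\<in>simplices K n. c \<sigma> * d \<sigma>)"
    if "c \<in> vecs (chain_space K n)" for c d
    using that by (intro sum.mono_neutral_right finite_simplices assms sub) auto
  then show ?thesis
    using sub by (auto simp: isometric_map_def linear_map_def inclusion_def)
qed

text \<open>Membership in the antistar is decided by \<open>v\<close> alone, so a simplex outside
  the antistar of \<open>K\<close> stays outside that of \<open>K'\<close>. For general
  \<open>L \<subseteq> L'\<close> the induced map need not even be injective.\<close>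

lemma isometric_map_rel_inclusion_antistar:
  assumes K: "finite K'" "K \<subseteq> K'"
  shows "isometric_map (rel_chains K (antistar K v) n) (rel_chains K' (antistar K' v) n)
    (rel_inclusion K' (antistar K' v) n)"
proof (rule isometric_map_rel_chains)
  show "finite K" using assms by (blast intro: finite_subset)
  show "linear_map (rel_chains K (antistar K v) n) (rel_chains K' (antistar K' v) n) (rel_inclusion K' (antistar K' v) n)"
    by (intro linear_map_rel_inclusion antistar_mono assms)
  fix c d :: "'a set \<Rightarrow> real"
  assume c: "c \<in> vecs (chain_space K n)"
  have "(\<Sum>\<sigma>\<in>simplices K' n - simplices (antistar K' v) n. c \<sigma> * d \<sigma>) =
      (\<Sum>\<sigma>\<in>simplices K n - simplices (antistar K v) n. c \<sigma> * d \<sigma>)"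
  proof (rule sum.mono_neutral_right)
    show "finite (simplices K' n - simplices (antistar K' v) n)" by (simp add: assms finite_simplices)
    show "simplices K n - simplices (antistar K v) n \<subseteq> simplices K' n - simplices (antistar K' v) n"
      using assms(2) by (auto simp: simplices_def antistar_def)
    show "\<forall>\<sigma>\<in>simplices K' n - simplices (antistar K' v) n - (simplices K n - simplices (antistar K v) n). c \<sigma> * d \<sigma> = 0"
      using c by (auto simp: simplices_def antistar_def)
  qed
  then show "ip (rel_chains K' (antistar K' v) n) (rel_inclusion K' (antistar K' v) n (rel_class K (antistar K v) n c))
      (rel_inclusion K' (antistar K' v) n (rel_class K (antistar K v) n d)) =
      (\<Sum>\<sigma>\<in>simplices K n - simplices (antistar K v) n. c \<sigma> * d \<sigma>)"
    by (simp only: rel_inclusion_rel_class[OF antistar_mono[OF assms(2)]] ip_rel_class[OF assms(1) antistar_subset])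
qed (rule antistar_subset)

section \<open>Relative degree zero\<close>

definition vertex_coefficient :: "'a \<Rightarrow> ('a set \<Rightarrow> real) set \<Rightarrow> real" where
  "vertex_coefficient v A = (SOME a. a \<in> A) {v}"

lemma vertex_coefficient_rel_class:
  "vertex_coefficient v (rel_class K (antistar K v) 0 c) = c {v}"
  unfolding vertex_coefficient_def by (rule some_rel_class_antistar) simp

lemma isometric_map_vertex_coefficient:
  assumes "finite K"
  shows "isometric_map (rel_chains K (antistar K v) 0) real_line (vertex_coefficient v)"
proof (rule isometric_map_rel_chains[OF assms antistar_subset])
  show "linear_map (rel_chains K (antistar K v) 0) real_line (vertex_coefficient v)"
    by (rule linear_map_rel_chains) (simp_all add: vertex_coefficient_rel_class real_line_def)
  fix c d :: "'a set \<Rightarrow> real"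
  assume c: "c \<in> vecs (chain_space K 0)"
  \<comment> \<open>Before the birth of \<open>v\<close> the left sum is empty and
    \<open>c {v}\<close> is 0, so one equation covers both cases.\<close>
  have "(\<Sum>\<sigma>\<in>simplices K 0 - simplices (antistar K v) 0. c \<sigma> * d \<sigma>) = (\<Sum>\<sigma>\<in>{{v}}. c \<sigma> * d \<sigma>)"
  proof (rule sum.mono_neutral_left)
    show "simplices K 0 - simplices (antistar K v) 0 \<subseteq> {{v}}"
      by (auto simp: simplices_def antistar_def card_1_singleton_iff)
    show "\<forall>\<sigma>\<in>{{v}} - (simplices K 0 - simplices (antistar K v) 0). c \<sigma> * d \<sigma> = 0"
      using c by (auto simp: simplices_def antistar_def)
  qed simp
  then show "ip real_line (vertex_coefficient v (rel_class K (antistar K v) 0 c)) (vertex_coefficient v (rel_class K (antistar K v) 0 d)) =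
      (\<Sum>\<sigma>\<in>simplices K 0 - simplices (antistar K v) 0. c \<sigma> * d \<sigma>)"
    by (simp add: vertex_coefficient_rel_class real_line_def)
qed

lemma boundary_simplex_vertex:
  assumes "\<rho> \<in> simplices K 0"
  shows "boundary_simplex (sorted_list_of_set \<rho>) {} = 1"
proof -
  obtain w where "\<rho> = {w}" using assms by (auto simp: simplices_def card_1_singleton_iff)
  then show ?thesis
    by (simp add: boundary_simplex_def drop_nth_def oriented_def inversions_def)
qed

text \<open>On generators: modulo the antistar \<open>[v, w]\<close> has boundary
  \<open>-[v]\<close>, and the link isomorphism sends it to \<open>-[w]\<close>, whose augmentation
  is -1 as well.\<close>

lemma vertex_coefficient_rel_boundary:
  assumes K: "finite_simplicial_complex K" and A: "A \<in> vecs (rel_chains K (antistar K v) 1)"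
  shows "vertex_coefficient v (rel_boundary K (antistar K v) 1 A) = augmentation (link K v) (link_iso K v 1 A)"
proof -
  have fin: "finite K" using K by (simp add: finite_simplicial_complex_def)
  obtain c where c: "A = rel_class K (antistar K v) 1 c"
    using A unfolding vecs_rel_chains by blast
  have "vertex_coefficient v (rel_boundary K (antistar K v) 1 A) = boundary K 1 c {v}"
    using rel_boundary_rel_class[OF finite_simplicial_complex_antistar[OF K] fin antistar_subset, of v 1 c]
    by (simp add: c vertex_coefficient_rel_class)
  also have "\<dots> = (\<Sum>\<rho>\<in>simplices (link K v) 0. link_sign v 1 \<rho> * c (insert v \<rho>) * boundary_simplex (sorted_list_of_set \<rho>) {})"
    using link_sign_boundary_chain[OF K, of 0 v "{}" c] by (simp add: link_sign_def)
  also have "\<dots> = augmentation (link K v) (link_iso K v 1 A)"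
    unfolding c link_iso_rel_class augmentation_def
    by (intro sum.cong) (auto simp: boundary_simplex_vertex)
  finally show ?thesis .
qed

lemma linear_map_augmentation: "linear_map (chain_space L 0) real_line (augmentation L)"
  by (simp add: linear_map_def real_line_def augmentation_def sum.distrib sum_distrib_left)

lemma adjoint_map_boundary_degree_0:
  assumes "finite_simplicial_complex L"
  shows "adjoint_map (chain_space L 0) (chain_space L (- 1)) (boundary L 0) (boundary L 0 c) = (\<lambda>\<sigma>. 0)"
proof (rule adjoint_map_eqI)
  have "finite L" using assms by (simp add: finite_simplicial_complex_def)
  then show "coordinatized (chain_space L 0) (simplices L 0) (\<lambda>c. c)"
    "coordinatized (chain_space L (- 1)) (simplices L (- 1)) (\<lambda>c. c)"
    by (rule coordinatized_chain_space)+
  show "linear_map (chain_space L 0) (chain_space L (- 1)) (boundary L 0)"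
    using linear_map_boundary[OF assms, of 0] by simp
qed (simp_all add: boundary_def)

section \<open>Unitary equivalence of the two persistent Laplacians\<close>

theorem theorem3p30:
  fixes K :: "int \<Rightarrow> 'a::linorder set set" and v :: 'a and i j n :: int
  assumes "persistence_complex K"
    and "{v} \<in> (\<Union>i. K i)"
    and "i \<le> j"
    and "n \<ge> 1"
  defines "C \<equiv> local_chains K v i n"
    and "Lk \<equiv> persistent_link K v"
  shows "\<exists>\<phi>. isometric_isomorphism C (chain_space (Lk i) (n - 1)) \<phi> \<and>
    (\<forall>ws. distinct (v # ws) \<and> int (length ws) = n \<and> set (v # ws) \<in> K i \<longrightarrow>
       \<phi> (rel_class (K i) (antistar (K i) v) n (oriented (v # ws)))
         = vscale (chain_space (Lk i) (n - 1)) ((- 1) ^ nat n) (oriented ws)) \<and>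
    (n \<ge> 2 \<longrightarrow> (\<forall>x\<in>vecs C. persistent_local_laplacian K v i j n x
       = inv_into (vecs C) \<phi> (persistent_complex_laplacian Lk i j (n - 1) (\<phi> x)))) \<and>
    (n = 1 \<longrightarrow> (\<forall>x\<in>vecs C. persistent_local_laplacian K v i j n x
       = inv_into (vecs C) \<phi> (vadd (chain_space (Lk i) (n - 1))
           (persistent_complex_laplacian Lk i j (n - 1) (\<phi> x))
           (augmentation_laplacian (Lk i) (\<phi> x)))))"
proof -
  have Ki: "finite_simplicial_complex (K i)" and Kj: "finite_simplicial_complex (K j)"
    and ij: "K i \<subseteq> K j"
    using assms(1,3) by (auto simp: persistence_complex_def)
  have fin: "finite (K i)" "finite (K j)"
    using Ki Kj by (auto simp: finite_simplicial_complex_def)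
  have Lk: "Lk i = link (K i) v" "Lk j = link (K j) v"
    unfolding Lk_def by (rule persistent_link_eq, fact)+
  have Li: "finite_simplicial_complex (Lk i)" and Lj: "finite_simplicial_complex (Lk j)"
    unfolding Lk by (rule finite_simplicial_complex_link, fact)+
  have finL: "finite (Lk i)" "finite (Lk j)"
    using Li Lj by (auto simp: finite_simplicial_complex_def)
  have Lij: "Lk i \<subseteq> Lk j" unfolding Lk by (rule link_mono[OF ij])
  let ?ai = "antistar (K i) v" and ?aj = "antistar (K j) v"
  let ?V = "\<lambda>m. rel_chains (K i) ?ai m" and ?W = "\<lambda>m. rel_chains (K j) ?aj m"
  let ?f = "rel_inclusion (K j) ?aj n" and ?D = "rel_boundary (K j) ?aj (n + 1)"
  let ?d = "rel_boundary (K i) ?ai n"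
  let ?\<phi> = "link_iso (K i) v n"
  let ?up = "up_laplacian (?V n) (?W n) ?f (?W (n + 1)) ?D"
  let ?up' = "up_laplacian (chain_space (Lk i) (n - 1)) (chain_space (Lk j) (n - 1)) inclusion
    (chain_space (Lk j) n) (boundary (Lk j) n)"
  note V = coordinatized_rel_chains[OF fin(1) antistar_subset[of _ v]]
    and W = coordinatized_rel_chains[OF fin(2) antistar_subset[of _ v]]
    and Vl = coordinatized_chain_space[OF finL(1)] and Wl = coordinatized_chain_space[OF finL(2)]
  have \<phi>: "isometric_isomorphism (?V m) (chain_space (Lk i) (m - 1)) (link_iso (K i) v m)" if "1 \<le> m" for m
    unfolding Lk by (rule isometric_isomorphism_link_iso[OF Ki that])
  have \<psi>: "isometric_isomorphism (?W m) (chain_space (Lk j) (m - 1)) (link_iso (K j) v m)" if "1 \<le> m" for m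
    unfolding Lk by (rule isometric_isomorphism_link_iso[OF Kj that])
  have \<psi>1: "isometric_isomorphism (?W (n + 1)) (chain_space (Lk j) n) (link_iso (K j) v (n + 1))"
    using \<psi>[of "n + 1"] assms(4) by simp
  have f: "isometric_map (?V n) (?W n) ?f" by (rule isometric_map_rel_inclusion_antistar[OF fin(2) ij])
  have D: "linear_map (?W (n + 1)) (?W n) ?D"
    using linear_map_rel_boundary[OF Kj finite_simplicial_complex_antistar[OF Kj, of v] antistar_subset, of "n + 1"]
    by simp
  have d: "linear_map (?V n) (?V (n - 1)) ?d"
    by (rule linear_map_rel_boundary[OF Ki finite_simplicial_complex_antistar[OF Ki] antistar_subset])
  have up: "?\<phi> (?up x) = ?up' (?\<phi> x)" if "x \<in> vecs C" for x
  proof (rule up_laplacian_transport[OF V W W Vl Wl Wl \<phi>[OF assms(4)] \<psi>[OF assms(4)] \<psi>1 f D])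
    show "isometric_map (chain_space (Lk i) (n - 1)) (chain_space (Lk j) (n - 1)) inclusion"
      by (rule isometric_map_inclusion[OF finL(2) Lij])
    show "linear_map (chain_space (Lk j) n) (chain_space (Lk j) (n - 1)) (boundary (Lk j) n)"
      by (rule linear_map_boundary[OF Lj])
    show "link_iso (K j) v n (?f y) = inclusion (?\<phi> y)" if "y \<in> vecs (?V n)" for y
      by (rule link_iso_rel_inclusion[OF Ki ij assms(4) that])
    show "link_iso (K j) v n (?D y) = boundary (Lk j) n (link_iso (K j) v (n + 1) y)" if "y \<in> vecs (?W (n + 1))" for y
      unfolding Lk by (rule link_iso_rel_boundary[OF Kj assms(4) that])
    show "x \<in> vecs (?V n)" using that by (simp add: C_def)
  qed
  let ?down = "\<lambda>x. adjoint_map (?V n) (?V (n - 1)) ?d (?d x)"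
  have d_in: "?d x \<in> vecs (?V (n - 1))" if "x \<in> vecs C" for x
    using d that by (simp add: linear_map_def C_def)
  have closed: "?up x \<in> vecs (?V n)" "?down x \<in> vecs (?V n)" if "x \<in> vecs C" for x
    using up_laplacian_closed[OF V W W f D, of x] is_adjoint_adjoint_map[OF V V d] d_in[OF that] that
    by (auto simp: is_adjoint_def linear_map_def C_def)
  have local_laplacian: "persistent_local_laplacian K v i j n x = vadd (?V n) (?up x) (?down x)" for x
    by (simp add: persistent_local_laplacian_def persistent_laplacian_up_down)
  \<comment> \<open>The down part is left in the form \<open>?\<phi> (?down x)\<close>, to be
    identified separately for \<open>n \<ge> 2\<close> and for \<open>n = 1\<close>.\<close>
  have split: "persistent_local_laplacian K v i j n x =
      inv_into (vecs C) ?\<phi> (vadd (chain_space (Lk i) (n - 1)) (?up' (?\<phi> x)) (?\<phi> (?down x)))"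
    if "x \<in> vecs C" for x
  proof -
    have "vadd (chain_space (Lk i) (n - 1)) (?up' (?\<phi> x)) (?\<phi> (?down x)) = ?\<phi> (vadd (?V n) (?up x) (?down x))"
      using \<phi>[OF assms(4)] closed[OF that] up[OF that]
      by (simp add: isometric_isomorphism_def linear_map_def)
    moreover have "vadd (?V n) (?up x) (?down x) \<in> vecs C"
      unfolding C_def by (rule coordinatized.add_closed[OF V closed[OF that]])
    moreover have "inj_on ?\<phi> (vecs C)"
      using \<phi>[OF assms(4)] by (simp add: C_def isometric_isomorphism_def bij_betw_def)
    ultimately show ?thesis
      by (simp only: local_laplacian inv_into_f_f)
  qed
  have link_laplacian: "persistent_complex_laplacian Lk i j (n - 1) y =
      vadd (chain_space (Lk i) (n - 1)) (?up' y)
        (adjoint_map (chain_space (Lk i) (n - 1)) (chain_space (Lk i) (n - 1 - 1)) (boundary (Lk i) (n - 1))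
          (boundary (Lk i) (n - 1) y))" for y
    by (simp only: persistent_complex_laplacian_def persistent_laplacian_up_down diff_add_cancel)
  \<comment> \<open>\<open>2 \<le> n\<close> ensures that the target degree \<open>n - 1\<close>
    still has \<open>link_iso\<close> as an isometry.\<close>
  have down: "?\<phi> (?down x) = adjoint_map (chain_space (Lk i) (n - 1)) (chain_space (Lk i) (n - 1 - 1))
      (boundary (Lk i) (n - 1)) (boundary (Lk i) (n - 1) (?\<phi> x))" if x: "x \<in> vecs C" and n: "2 \<le> n" for x
  proof -
    have comm: "link_iso (K i) v (n - 1) (?d y) = boundary (Lk i) (n - 1) (?\<phi> y)" if "y \<in> vecs (?V n)" for y
      using link_iso_rel_boundary[OF Ki, of "n - 1" y v] n that unfolding Lk by simp
    have lin: "linear_map (chain_space (Lk i) (n - 1)) (chain_space (Lk i) (n - 1 - 1)) (boundary (Lk i) (n - 1))"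
      by (rule linear_map_boundary[OF Li])
    have q: "isometric_map (?V (n - 1)) (chain_space (Lk i) (n - 1 - 1)) (link_iso (K i) v (n - 1))"
      using isometric_isomorphism_imp_map[OF \<phi>[of "n - 1"]] n by simp
    have "?\<phi> (?down x) = adjoint_map (chain_space (Lk i) (n - 1)) (chain_space (Lk i) (n - 1 - 1))
      (boundary (Lk i) (n - 1)) (link_iso (K i) v (n - 1) (?d x))"
      by (rule adjoint_map_transport[OF V V d Vl Vl lin \<phi>[OF assms(4)] q])
        (use comm d_in[OF x] in auto)
    then show ?thesis using comm x by (simp add: C_def)
  qed
  have down1: "?\<phi> (?down x) = augmentation_laplacian (Lk i) (?\<phi> x)" if x: "x \<in> vecs C" and n: "n = 1" for x
  proof -
    have comm: "vertex_coefficient v (?d y) = augmentation (Lk i) (?\<phi> y)" if "y \<in> vecs (?V n)" for y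
      using vertex_coefficient_rel_boundary[OF Ki, of y v] that unfolding Lk n by simp
    have q: "isometric_map (?V (n - 1)) real_line (vertex_coefficient v)"
      using isometric_map_vertex_coefficient[OF fin(1), of v] n by simp
    have aug: "linear_map (chain_space (Lk i) (n - 1)) real_line (augmentation (Lk i))"
      using linear_map_augmentation n by simp
    have "?\<phi> (?down x) = adjoint_map (chain_space (Lk i) (n - 1)) real_line (augmentation (Lk i))
        (vertex_coefficient v (?d x))"
      by (rule adjoint_map_transport[OF V V d Vl coordinatized_real_line aug \<phi>[OF assms(4)] q])
        (use comm d_in[OF x] in auto)
    then show ?thesis using comm[of x] x n by (simp add: C_def augmentation_laplacian_def)
  qed
  show ?thesis
  proof (intro exI[of _ ?\<phi>] conjI allI impI ballI)
    show "isometric_isomorphism C (chain_space (Lk i) (n - 1)) ?\<phi>"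
      unfolding C_def by (rule \<phi>[OF assms(4)])
    show "?\<phi> (rel_class (K i) ?ai n (oriented (v # ws))) =
        vscale (chain_space (Lk i) (n - 1)) ((- 1) ^ nat n) (oriented ws)"
      if "distinct (v # ws) \<and> int (length ws) = n \<and> set (v # ws) \<in> K i" for ws
      unfolding chain_space_simps using that assms(4) by (intro link_iso_oriented[OF Ki]) auto
    show "persistent_local_laplacian K v i j n x =
        inv_into (vecs C) ?\<phi> (persistent_complex_laplacian Lk i j (n - 1) (?\<phi> x))"
      if "2 \<le> n" "x \<in> vecs C" for x
      unfolding split[OF that(2)] down[OF that(2,1)] link_laplacian ..
    show "persistent_local_laplacian K v i j n x =
        inv_into (vecs C) ?\<phi> (vadd (chain_space (Lk i) (n - 1))
          (persistent_complex_laplacian Lk i j (n - 1) (?\<phi> x)) (augmentation_laplacian (Lk i) (?\<phi> x)))"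
      if n: "n = 1" and x: "x \<in> vecs C" for x
    proof -
      \<comment> \<open>In degree 0 the down part of the link itself vanishes, so the augmentation
        term is exactly what has to be added.\<close>
      have "persistent_complex_laplacian Lk i j (n - 1) (?\<phi> x) = ?up' (?\<phi> x)"
        unfolding link_laplacian using adjoint_map_boundary_degree_0[OF Li] n by simp
      then show ?thesis unfolding split[OF x] down1[OF x n] by simp
    qed
  qed
qed

end
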